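(* Let $h:\mathbb{R}^m\to\mathbb{R}\cup\{+\infty\}$ be piecewise linear-quadratic and convex, let $c:\mathbb{R}^n\to\mathbb{R}^m$ be $C^2$-smooth, $f:=h\circ c$, $\bar x\in\mathrm{dom}(f)$. Suppose $M(\bar x):=\mathrm{Null}(\nabla c(\bar x)^\top)\cap\partial h(c(\bar x))=\{\bar y\}$ and the second-order sufficient condition $$h''(c(\bar x);\nabla c(\bar x)d)+\langle d,\nabla^2(\bar yc)(\bar x)d\rangle>0\quad\text{for all }d\in D(\bar x)\setminus\{0\}$$ holds. Then $(\bar x,\bar y)$ solves $0\in g(\bar x,\bar y)+G(\bar x,\bar y)$, where $g(x,y)=(\nabla c(x)^\top y,\,-c(x))$ and $G(x,y)=\{0\}^n\times\partial h^\star(y)$. Moreover, there exists a neighborhood $U$ of $(\bar x,\bar y)$ such that the following holds: if $(x^0,y^0)\in U$, $\{B_k\}\subset\mathbb{R}^{n\times n}$, the sequence $\{(x^k,y^k)\}_{k\in\mathbb{N}}$ is generated by the quasi-Newton optimality conditions $$B_k[x^{k+1}-x^k]+\nabla c(x^k)^\top y^{k+1}=0,\qquad y^{k+1}\in\partial h\big(c(x^k)+\nabla c(x^k)[x^{k+1}-x^k]\big),$$ it remains in $U$ with $(x^k,y^k)\ne(\bar x,\bar y)$ for all $k\in\mathbb{N}$, and $$(x^k,y^k)\to(\bar x,\bar y)\quad\text{and}\quad (B_k-\nabla^2(y^kc)(x^k))[x^{k+1}-x^k]=o(\|s^k\|),\qquad s^k:=(x^{k+1}-x^k,\,y^{k+1}-y^k),$$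 then $(x^k,y^k)\to(\bar x,\bar y)$ superlinearly.
   Context: A proper function $h$ is piecewise linear-quadratic (PLQ) if $\mathrm{dom}(h)$ is nonempty and is the union of finitely many polyhedral sets, relative to each of which $h(c)=\frac12\langle c,Q_kc\rangle+\langle b_k,c\rangle+\beta_k$ with $Q_k$ symmetric. $\partial h$ is the convex subdifferential, $h^\star$ the Fenchel conjugate. $\nabla c(x)$ is the $m\times n$ Jacobian and $(yc)(x):=\langle y,c(x)\rangle$. $h'(c;w)$ is the one-sided directional derivative and $h''(c;w)=\lim_{t\searrow0}\frac{h(c+tw)-h(c)-th'(c;w)}{\frac12t^2}$ . $D(\bar x):=\{d:h'(c(\bar x);\nabla c(\bar x)d)\le0\}$. The quasi-Newton conditions are the first-order optimality conditions for minimizing $d\mapsto h(c(x^k)+\nabla c(x^k)d)+\frac12d^\top B_kd$, with $x^{k+1}=x^k+d^k$. Superlinear convergence of $z^k\to\bar z$ (with $z^k\neq\bar z$) means $\|z^{k+1}-\bar z\|/\|z^k-\bar z\|\to0$. *)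

theory Defs
  imports "HOL-Analysis.Analysis" "HOL-Library.Landau_Symbols"
begin

subsection \<open>Extended-real-valued convex analysis\<close>

definition edom :: "('a \<Rightarrow> ereal) \<Rightarrow> 'a set" where
  "edom h = {x. h x < \<infinity>}"

definition proper_fun :: "('a \<Rightarrow> ereal) \<Rightarrow> bool" where
  "proper_fun h \<longleftrightarrow> edom h \<noteq> {} \<and> (\<forall>x. h x \<noteq> -\<infinity>)"

text \<open>Convexity of an extended-real-valued function is convexity of its epigraph, as a subset
  of \<open>'a \<times> real\<close>; the library's \<open>convex_on\<close> only covers real-valued functions.\<close>

definition econvex :: "('a::real_vector \<Rightarrow> ereal) \<Rightarrow> bool" where
  "econvex h \<longleftrightarrow> convex {(x, r::real). h x \<le> ereal r}"

definition plq :: "(real^'m \<Rightarrow> ereal) \<Rightarrow> bool" where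
  "plq h \<longleftrightarrow> proper_fun h \<and>
     (\<exists>(N::nat) (C :: nat \<Rightarrow> (real^'m) set) (Q :: nat \<Rightarrow> real^'m^'m)
        (b :: nat \<Rightarrow> real^'m) (\<beta> :: nat \<Rightarrow> real).
        edom h = (\<Union>k<N. C k) \<and>
        (\<forall>k<N. polyhedron (C k) \<and> transpose (Q k) = Q k \<and>
           (\<forall>u\<in>C k. h u = ereal (1/2 * (u \<bullet> (Q k *v u)) + b k \<bullet> u + \<beta> k))))"

text \<open>The subdifferential is empty at points where the function is not finite.\<close>

definition subdifferential :: "('a::real_inner \<Rightarrow> ereal) \<Rightarrow> 'a \<Rightarrow> 'a set" where
  "subdifferential h u = {v. \<bar>h u\<bar> \<noteq> \<infinity> \<and> (\<forall>w. h u + ereal (v \<bullet> (w - u)) \<le> h w)}"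

definition conjugate :: "('a::real_inner \<Rightarrow> ereal) \<Rightarrow> 'a \<Rightarrow> ereal" where
  "conjugate h y = (SUP u. ereal (y \<bullet> u) - h u)"

text \<open>Both one-sided derivatives are limits in the extended reals. At a point of the domain of a
  convex function the first one always exists (possibly infinite). The second one is only
  meaningful for directions in which the first one is finite.\<close>

definition dir_deriv :: "('a::real_vector \<Rightarrow> ereal) \<Rightarrow> 'a \<Rightarrow> 'a \<Rightarrow> ereal" where
  "dir_deriv h u w = Lim (at_right (0::real)) (\<lambda>t. (h (u + t *\<^sub>R w) - h u) / ereal t)"

definition dir_deriv2 :: "('a::real_vector \<Rightarrow> ereal) \<Rightarrow> 'a \<Rightarrow> 'a \<Rightarrow> ereal" where
  "dir_deriv2 h u w = Lim (at_right (0::real))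
     (\<lambda>t. (h (u + t *\<^sub>R w) - h u - ereal t * dir_deriv h u w) / ereal (1/2 * t\<^sup>2))"

subsection \<open>Smooth maps\<close>

definition C1_smooth :: "('a::real_normed_vector \<Rightarrow> 'b::real_normed_vector) \<Rightarrow> bool" where
  "C1_smooth f \<longleftrightarrow> (\<exists>f' :: 'a \<Rightarrow> 'a \<Rightarrow>\<^sub>L 'b.
     (\<forall>x. (f has_derivative blinfun_apply (f' x)) (at x)) \<and> continuous_on UNIV f')"

definition C2_smooth :: "('a::real_normed_vector \<Rightarrow> 'b::real_normed_vector) \<Rightarrow> bool" where
  "C2_smooth f \<longleftrightarrow> (\<exists>f' :: 'a \<Rightarrow> 'a \<Rightarrow>\<^sub>L 'b.
     (\<forall>x. (f has_derivative blinfun_apply (f' x)) (at x)) \<and> C1_smooth f')"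

abbreviation jac :: "(real^'n \<Rightarrow> real^'m) \<Rightarrow> real^'n \<Rightarrow> real^'n^'m" where
  "jac c x \<equiv> jacobian c (at x)"

definition grad :: "(real^'n \<Rightarrow> real) \<Rightarrow> real^'n \<Rightarrow> real^'n" where
  "grad \<phi> x = (\<chi> i. frechet_derivative \<phi> (at x) (axis i 1))"

definition hessian :: "(real^'n \<Rightarrow> real) \<Rightarrow> real^'n \<Rightarrow> real^'n^'n" where
  "hessian \<phi> x = jac (grad \<phi>) x"

definition scalarized :: "real^'m \<Rightarrow> (real^'n \<Rightarrow> real^'m) \<Rightarrow> real^'n \<Rightarrow> real" where
  "scalarized y c = (\<lambda>x. y \<bullet> c x)"

subsection \<open>The convex-composite problem\<close>

definition multipliers ::
  "(real^'m \<Rightarrow> ereal) \<Rightarrow> (real^'n \<Rightarrow> real^'m) \<Rightarrow> real^'n \<Rightarrow> (real^'m) set" where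
  "multipliers h c x = {y. transpose (jac c x) *v y = 0} \<inter> subdifferential h (c x)"

definition nonascent_dirs ::
  "(real^'m \<Rightarrow> ereal) \<Rightarrow> (real^'n \<Rightarrow> real^'m) \<Rightarrow> real^'n \<Rightarrow> (real^'n) set" where
  "nonascent_dirs h c x = {d. dir_deriv h (c x) (jac c x *v d) \<le> 0}"

definition ge_map ::
  "(real^'n \<Rightarrow> real^'m) \<Rightarrow> (real^'n) \<times> (real^'m) \<Rightarrow> (real^'n) \<times> (real^'m)" where
  "ge_map c = (\<lambda>(x, y). (transpose (jac c x) *v y, - c x))"

definition ge_setmap ::
  "(real^'m \<Rightarrow> ereal) \<Rightarrow> (real^'n) \<times> (real^'m) \<Rightarrow> ((real^'n) \<times> (real^'m)) set" where
  "ge_setmap h = (\<lambda>(x, y). {0} \<times> subdifferential (conjugate h) y)"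

definition quasi_newton ::
  "(real^'m \<Rightarrow> ereal) \<Rightarrow> (real^'n \<Rightarrow> real^'m) \<Rightarrow> (nat \<Rightarrow> real^'n^'n) \<Rightarrow>
   (nat \<Rightarrow> real^'n) \<Rightarrow> (nat \<Rightarrow> real^'m) \<Rightarrow> bool" where
  "quasi_newton h c B x y \<longleftrightarrow> (\<forall>k.
     B k *v (x (Suc k) - x k) + transpose (jac c (x k)) *v y (Suc k) = 0 \<and>
     y (Suc k) \<in> subdifferential h (c (x k) + jac c (x k) *v (x (Suc k) - x k)))"

text \<open>The quotient is only meaningful because \<open>z\<close> never attains its limit.\<close>

definition superlinear_conv :: "(nat \<Rightarrow> 'a::real_normed_vector) \<Rightarrow> 'a \<Rightarrow> bool" where
  "superlinear_conv z l \<longleftrightarrow> z \<longlonglongrightarrow> l \<and> (\<forall>k. z k \<noteq> l) \<and>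
     (\<lambda>k. norm (z (Suc k) - l) / norm (z k - l)) \<longlonglongrightarrow> 0"

end

theory Submission
  imports Defs
begin

text \<open>
  The heart of the matter is an error bound: near \<open>(xbar, ybar)\<close>, every solution of the optimality
  conditions perturbed by a residual lies within a constant times the residual of \<open>(xbar, ybar)\<close>.
  If it failed, perturbed solutions \<open>zbar + t\<^sub>k \<zeta>\<^sub>k\<close> with \<open>t\<^sub>k\<close> tending to 0, \<open>\<zeta>\<^sub>k\<close> tending to a unit
  vector \<open>(d, v)\<close> and residuals \<open>o(t\<^sub>k)\<close> would exist; in the limit,
  \<open>H d + J\<^sup>T v = 0\<close>, where \<open>H\<close> is the Hessian of the Lagrangian and \<open>J\<close> the Jacobian of \<open>c\<close>.
  Infinitely many of the points at which the subgradients are taken lie in a single piece of \<open>h\<close>,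
  which forces \<open>h'(c(xbar); J d) = \<langle>ybar, J d\<rangle> = 0\<close> and \<open>h''(c(xbar); J d) \<le> \<langle>v, J d\<rangle> = - \<langle>d, H d\<rangle>\<close>;
  the second-order condition then gives \<open>d = 0\<close>. Finally \<open>ybar + s v\<close> is a multiplier for small
  \<open>s > 0\<close> because the pieces are polyhedral, so \<open>v = 0\<close> by uniqueness, a contradiction.

  A quasi-Newton iterate solves the perturbed conditions with residual \<open>o(norm s\<^sub>k)\<close>, by strict
  differentiability of \<open>c\<close> and of the gradient of the Lagrangian together with the Dennis-More
  condition, and \<open>norm s\<^sub>k \<le> norm (z\<^sub>k\<^sub>+\<^sub>1 - zbar) + norm (z\<^sub>k - zbar)\<close>.
\<close>

subsection \<open>Subgradients of piecewise linear-quadratic functions\<close>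

definition quad :: "real^'m^'m \<Rightarrow> real^'m \<Rightarrow> real \<Rightarrow> real^'m \<Rightarrow> real" where
  "quad Q b \<beta> u = 1/2 * (u \<bullet> (Q *v u)) + b \<bullet> u + \<beta>"

definition quad_piece ::
  "(real^'m \<Rightarrow> ereal) \<Rightarrow> (real^'m) set \<Rightarrow> real^'m^'m \<Rightarrow> real^'m \<Rightarrow> real \<Rightarrow> bool" where
  "quad_piece h S Q b \<beta> \<longleftrightarrow>
     polyhedron S \<and> transpose Q = Q \<and> (\<forall>u\<in>S. h u = ereal (quad Q b \<beta> u))"

lemma plqE:
  fixes h :: "real^'m \<Rightarrow> ereal"
  assumes "plq h"
  obtains N :: nat and C Q b \<beta>
  where "edom h = (\<Union>k<N. C k)" "\<And>k. k < N \<Longrightarrow> quad_piece h (C k) (Q k) (b k) (\<beta> k)"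
proof -
  obtain N :: nat and C Q b \<beta> where "edom h = (\<Union>k<N. C k)"
    and "\<forall>k<N. polyhedron (C k) \<and> transpose (Q k) = Q k \<and>
      (\<forall>u\<in>C k. h u = ereal (1/2 * (u \<bullet> (Q k *v u)) + b k \<bullet> u + \<beta> k))"
    using assms unfolding plq_def by (elim conjE exE)
  then show ?thesis
    by (intro that[of C N Q b \<beta>]) (simp_all add: quad_piece_def quad_def)
qed

lemma symmetric_inner_matrix:
  fixes Q :: "real^'m^'m"
  assumes "transpose Q = Q"
  shows "(Q *v u) \<bullet> e = u \<bullet> (Q *v e)"
  by (metis assms dot_lmul_matrix transpose_matrix_vector)

lemma quad_along_ray:
  fixes Q :: "real^'m^'m"
  assumes "transpose Q = Q"
  shows "quad Q b \<beta> (u + t *\<^sub>R e) =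
    quad Q b \<beta> u + t * ((Q *v u + b) \<bullet> e) + t\<^sup>2 / 2 * (e \<bullet> (Q *v e))"
proof -
  have "e \<bullet> (Q *v u) = u \<bullet> (Q *v e)"
    using symmetric_inner_matrix[OF assms, of u e] by (simp add: inner_commute)
  moreover have "(Q *v u) \<bullet> e = u \<bullet> (Q *v e)"
    by (rule symmetric_inner_matrix[OF assms])
  ultimately show ?thesis
    unfolding quad_def
    by (simp add: matrix_vector_right_distrib matrix_vector_mult_scaleR inner_add_left
        inner_add_right power2_eq_square algebra_simps)
qed

section \<open>Subgradients, tangent rays and one-sided derivatives on a single piece\<close>

lemma subdifferential_finite:
  assumes "y \<in> subdifferential h u"
  obtains a where "h u = ereal a"
  using assms unfolding subdifferential_def by (cases "h u") auto

lemma subdifferential_ineq: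
  assumes "y \<in> subdifferential h u" "h u = ereal a" "h w = ereal b"
  shows "a + y \<bullet> (w - u) \<le> b"
proof -
  have "h u + ereal (y \<bullet> (w - u)) \<le> h w"
    using assms(1) unfolding subdifferential_def by blast
  then show ?thesis using assms by simp
qed

lemma subdifferential_edom: "y \<in> subdifferential h u \<Longrightarrow> u \<in> edom h"
  unfolding subdifferential_def edom_def by auto

text \<open>The cone of feasible directions of a polyhedron is closed. Of the finitely many
  half-spaces, one active at \<open>u\<close> has a normal with nonpositive inner product with every
  \<open>\<omega> k\<close>, hence with \<open>w\<close>, and contains the whole ray; an inactive
  one contains an initial part of it.\<close>

lemma polyhedron_tangent_ray:
  assumes "polyhedron S" "u \<in> S" "\<And>k. u + t k *\<^sub>R \<omega> k \<in> S" "\<And>k. 0 < t k"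
    and "\<omega> \<longlonglongrightarrow> w"
  shows "\<forall>\<^sub>F s in at_right 0. u + s *\<^sub>R w \<in> S"
proof -
  obtain F where F: "finite F" "S = \<Inter>F" "\<And>H. H \<in> F \<Longrightarrow> \<exists>a b. H = {x. a \<bullet> x \<le> b}"
    using assms(1) unfolding polyhedron_def by metis
  have "\<forall>\<^sub>F s in at_right 0. u + s *\<^sub>R w \<in> H" if H: "H \<in> F" for H
  proof -
    obtain a b where ab: "H = {x. a \<bullet> x \<le> b}" using F(3)[OF H] by blast
    have u: "a \<bullet> u \<le> b" using assms(2) F(2) H ab by auto
    show ?thesis
    proof (cases "a \<bullet> u = b")
      case True
      have "a \<bullet> \<omega> k \<le> 0" for k
      proof -
        have "u + t k *\<^sub>R \<omega> k \<in> H" using assms(3) F(2) H by auto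
        then have "t k * (a \<bullet> \<omega> k) \<le> 0" using ab True by (simp add: inner_add_right)
        then show ?thesis using assms(4)[of k] by (simp add: mult_le_0_iff)
      qed
      moreover have "(\<lambda>k. a \<bullet> \<omega> k) \<longlonglongrightarrow> a \<bullet> w" by (intro tendsto_intros assms)
      ultimately have "a \<bullet> w \<le> 0" by (auto intro: LIMSEQ_le_const2)
      then have "u + s *\<^sub>R w \<in> H" if "s > 0" for s
        using ab True that by (simp add: inner_add_right mult_le_0_iff)
      then show ?thesis
        using eventually_mono[OF eventually_at_right_less, of _ "\<lambda>s. u + s *\<^sub>R w \<in> H"] by simp
    next
      case False
      have "((\<lambda>s. a \<bullet> (u + s *\<^sub>R w)) \<longlongrightarrow> a \<bullet> (u + 0 *\<^sub>R w)) (at_right 0)"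
        by (intro tendsto_intros)
      moreover have "a \<bullet> (u + 0 *\<^sub>R w) < b" using u False by simp
      ultimately have "\<forall>\<^sub>F s in at_right 0. a \<bullet> (u + s *\<^sub>R w) < b" by (rule order_tendstoD)
      then show ?thesis by (rule eventually_mono) (simp add: ab)
    qed
  qed
  then have "\<forall>\<^sub>F s in at_right 0. \<forall>H\<in>F. u + s *\<^sub>R w \<in> H"
    using F(1) by (simp add: eventually_ball_finite_distrib)
  then show ?thesis by (simp add: F(2))
qed

lemma dir_derivs_quad_piece:
  fixes h :: "real^'m \<Rightarrow> ereal"
  assumes piece: "quad_piece h S Q b \<beta>" and "u \<in> S"
    and ray: "\<forall>\<^sub>F s in at_right 0. u + s *\<^sub>R w \<in> S"
  shows "dir_deriv h u w = ereal ((Q *v u + b) \<bullet> w)"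
    and "dir_deriv2 h u w = ereal (w \<bullet> (Q *v w))"
proof -
  let ?a = "(Q *v u + b) \<bullet> w" and ?q = "w \<bullet> (Q *v w)"
  have val: "h (u + s *\<^sub>R w) = ereal (quad Q b \<beta> u + s * ?a + s\<^sup>2 / 2 * ?q)"
    if "u + s *\<^sub>R w \<in> S" for s
    using piece that quad_along_ray[of Q b \<beta> u s w] by (simp add: quad_piece_def)
  have hu: "h u = ereal (quad Q b \<beta> u)" using piece assms(2) by (simp add: quad_piece_def)
  have "\<forall>\<^sub>F s in at_right 0. ereal (?a + s / 2 * ?q) = (h (u + s *\<^sub>R w) - h u) / ereal s"
    using ray eventually_at_right_less[of "0::real"]
    by eventually_elim (simp add: val hu field_simps power2_eq_square)
  moreover have "((\<lambda>s. ereal (?a + s / 2 * ?q)) \<longlongrightarrow> ereal (?a + 0 / 2 * ?q)) (at_right 0)"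
    by (intro tendsto_intros) auto
  ultimately have "((\<lambda>s. (h (u + s *\<^sub>R w) - h u) / ereal s) \<longlongrightarrow> ereal (?a + 0 / 2 * ?q))
      (at_right 0)" by (rule Lim_transform_eventually[rotated])
  then have "((\<lambda>s. (h (u + s *\<^sub>R w) - h u) / ereal s) \<longlongrightarrow> ereal ?a) (at_right 0)" by simp
  then show d: "dir_deriv h u w = ereal ?a"
    unfolding dir_deriv_def by (intro tendsto_Lim) auto
  have "\<forall>\<^sub>F s in at_right 0. ereal ?q =
      (h (u + s *\<^sub>R w) - h u - ereal s * dir_deriv h u w) / ereal (1/2 * s\<^sup>2)"
    using ray eventually_at_right_less[of "0::real"]
    by eventually_elim (simp add: val hu d)
  then have "((\<lambda>s. (h (u + s *\<^sub>R w) - h u - ereal s * dir_deriv h u w) / ereal (1/2 * s\<^sup>2))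
      \<longlongrightarrow> ereal ?q) (at_right 0)"
    by (rule Lim_transform_eventually[OF tendsto_const])
  then show "dir_deriv2 h u w = ereal ?q"
    unfolding dir_deriv2_def by (intro tendsto_Lim) auto
qed

text \<open>The point \<open>u\<close> minimizes \<open>h\<close> minus the linear function given by
  \<open>y\<close> over the convex set \<open>S\<close>; this is the first-order condition along the
  segment towards \<open>p\<close>.\<close>

lemma subdifferential_normal:
  fixes h :: "real^'m \<Rightarrow> ereal"
  assumes piece: "quad_piece h S Q b \<beta>" and "u \<in> S" "p \<in> S" "y \<in> subdifferential h u"
  shows "0 \<le> (Q *v u + b - y) \<bullet> (p - u)"
proof -
  let ?e = "p - u"
  have "(Q *v u + b - y) \<bullet> ?e + s / 2 * (?e \<bullet> (Q *v ?e)) \<ge> 0" if s: "0 < s" "s \<le> 1" for s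
  proof -
    have "convex S" using piece by (simp add: quad_piece_def polyhedron_imp_convex)
    then have "(1 - s) *\<^sub>R u + s *\<^sub>R p \<in> S"
      using assms s by (intro convexD) auto
    moreover have "(1 - s) *\<^sub>R u + s *\<^sub>R p = u + s *\<^sub>R ?e" by (simp add: algebra_simps)
    ultimately have "u + s *\<^sub>R ?e \<in> S" by simp
    then have "quad Q b \<beta> u + y \<bullet> (u + s *\<^sub>R ?e - u) \<le> quad Q b \<beta> (u + s *\<^sub>R ?e)"
      using piece assms by (intro subdifferential_ineq[of y h]) (auto simp: quad_piece_def)
    moreover have "transpose Q = Q" using piece by (simp add: quad_piece_def)
    ultimately have "0 \<le> s * ((Q *v u + b - y) \<bullet> ?e + s / 2 * (?e \<bullet> (Q *v ?e)))"
      by (simp only: quad_along_ray)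
        (simp add: inner_diff_left power2_eq_square algebra_simps)
    then show ?thesis using s by (simp add: zero_le_mult_iff)
  qed
  then have "\<forall>\<^sub>F s in at_right 0. 0 \<le> (Q *v u + b - y) \<bullet> ?e + s / 2 * (?e \<bullet> (Q *v ?e))"
    by (auto simp: eventually_at_right_field intro!: exI[of _ 1])
  moreover have "((\<lambda>s. (Q *v u + b - y) \<bullet> ?e + s / 2 * (?e \<bullet> (Q *v ?e))) \<longlongrightarrow>
      (Q *v u + b - y) \<bullet> ?e + 0 / 2 * (?e \<bullet> (Q *v ?e))) (at_right 0)"
    by (intro tendsto_intros) auto
  ultimately have "0 \<le> (Q *v u + b - y) \<bullet> ?e + 0 / 2 * (?e \<bullet> (Q *v ?e))"
    by (intro tendsto_lowerbound) auto
  then show ?thesis by simp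
qed

section \<open>Subgradients along sequences converging to a base point\<close>

lemma tendsto_matrix_vector_mult:
  fixes Q :: "real^'n^'m"
  assumes "(f \<longlongrightarrow> l) F"
  shows "((\<lambda>x. Q *v f x) \<longlongrightarrow> Q *v l) F"
  by (rule bounded_linear.tendsto[OF matrix_vector_mul_bounded_linear assms])

text \<open>Both claims come from testing the normal-cone inequality of \<open>subdifferential_normal\<close> at \<open>u\<close>
  towards \<open>u + t k *\<^sub>R \<omega> k\<close> and conversely, and adding the two.\<close>

lemma subdifferential_tangent_quad_piece:
  fixes h :: "real^'m \<Rightarrow> ereal"
  assumes piece: "quad_piece h S Q b \<beta>" and u: "u \<in> S" and y: "y \<in> subdifferential h u"
    and uS: "\<And>k. u + t k *\<^sub>R \<omega> k \<in> S"
    and yk: "\<And>k. y + t k *\<^sub>R v k \<in> subdifferential h (u + t k *\<^sub>R \<omega> k)"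
    and t: "\<And>k. 0 < t k" "t \<longlonglongrightarrow> 0" and lim: "\<omega> \<longlonglongrightarrow> w" "v \<longlonglongrightarrow> v'"
  shows "(Q *v u + b) \<bullet> w = y \<bullet> w" "w \<bullet> (Q *v w) \<le> v' \<bullet> w"
proof -
  let ?g = "Q *v u + b - y"
  have lo: "0 \<le> ?g \<bullet> \<omega> k" for k
  proof -
    have "0 \<le> t k * (?g \<bullet> \<omega> k)" using subdifferential_normal[OF piece u uS y, of k] by simp
    then show ?thesis using t(1)[of k] by (simp add: zero_le_mult_iff)
  qed
  have hi: "?g \<bullet> \<omega> k + t k * ((Q *v \<omega> k - v k) \<bullet> \<omega> k) \<le> 0" for k
  proof -
    have "0 \<le> (Q *v (u + t k *\<^sub>R \<omega> k) + b - (y + t k *\<^sub>R v k)) \<bullet> (u - (u + t k *\<^sub>R \<omega> k))"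
      by (rule subdifferential_normal[OF piece uS u yk])
    also have "\<dots> = - (t k * (?g \<bullet> \<omega> k + t k * ((Q *v \<omega> k - v k) \<bullet> \<omega> k)))"
      by (simp add: matrix_vector_right_distrib matrix_vector_mult_scaleR inner_diff_left
          inner_add_left algebra_simps)
    finally show ?thesis using t(1)[of k] by (simp add: mult_le_0_iff)
  qed
  have gl: "(\<lambda>k. ?g \<bullet> \<omega> k) \<longlonglongrightarrow> ?g \<bullet> w" by (intro tendsto_intros lim)
  have ql: "(\<lambda>k. (Q *v \<omega> k - v k) \<bullet> \<omega> k) \<longlonglongrightarrow> (Q *v w - v') \<bullet> w"
    by (intro tendsto_intros tendsto_matrix_vector_mult lim)
  have "0 \<le> ?g \<bullet> w" using gl lo by (auto intro: LIMSEQ_le_const)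
  moreover have "(\<lambda>k. ?g \<bullet> \<omega> k + t k * ((Q *v \<omega> k - v k) \<bullet> \<omega> k)) \<longlonglongrightarrow>
      ?g \<bullet> w + 0 * ((Q *v w - v') \<bullet> w)"
    by (intro tendsto_add tendsto_mult gl ql t)
  then have "?g \<bullet> w + 0 * ((Q *v w - v') \<bullet> w) \<le> 0" using hi by (auto intro: LIMSEQ_le_const2)
  ultimately show "(Q *v u + b) \<bullet> w = y \<bullet> w" by (simp add: inner_diff_left)
  \<comment> \<open>The limit of \<open>hi\<close> loses the curvature term because of its factor
    \<open>t k\<close>. Dropping \<open>?g \<bullet> \<omega> k\<close>, nonnegative by
    \<open>lo\<close>, and cancelling \<open>t k\<close> first preserves it.\<close>
  have "(Q *v \<omega> k - v k) \<bullet> \<omega> k \<le> 0" for k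
  proof -
    have "t k * ((Q *v \<omega> k - v k) \<bullet> \<omega> k) \<le> 0" using lo[of k] hi[of k] by linarith
    then show ?thesis using t(1)[of k] by (simp add: mult_le_0_iff)
  qed
  then have "(Q *v w - v') \<bullet> w \<le> 0" using ql by (auto intro: LIMSEQ_le_const2)
  then show "w \<bullet> (Q *v w) \<le> v' \<bullet> w"
    by (simp add: inner_diff_left inner_commute[of w])
qed

text \<open>Finitely many pieces cover the points, so a subsequence stays in one \<open>C j\<close>.
  That piece is closed and polyhedral, hence contains \<open>u\<close> and the beginning of the ray
  along \<open>w\<close>, and a single quadratic determines both derivatives. The upper bound on the
  curvature is what will contradict the second-order condition.\<close>

lemma dir_derivs_subdifferential_tangent:
  fixes h :: "real^'m \<Rightarrow> ereal"
  assumes "plq h" and y: "y \<in> subdifferential h u"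
    and yk: "\<And>k. y + t k *\<^sub>R v k \<in> subdifferential h (u + t k *\<^sub>R \<omega> k)"
    and t: "\<And>k. 0 < t k" "t \<longlonglongrightarrow> 0" and lim: "\<omega> \<longlonglongrightarrow> w" "v \<longlonglongrightarrow> v'"
  shows "dir_deriv h u w = ereal (y \<bullet> w)"
    and "\<exists>q. dir_deriv2 h u w = ereal q \<and> q \<le> v' \<bullet> w"
proof -
  obtain N :: nat and C Q b \<beta> where dom: "edom h = (\<Union>j<N. C j)"
    and piece: "\<And>j. j < N \<Longrightarrow> quad_piece h (C j) (Q j) (b j) (\<beta> j)"
    by (rule plqE[OF assms(1)]) (rule that; assumption)
  have "\<exists>\<^sub>F k in sequentially. \<exists>j\<in>{..<N}. u + t k *\<^sub>R \<omega> k \<in> C j"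
    using subdifferential_edom[OF yk] dom by (intro eventually_frequently) auto
  then obtain j where j: "j < N" "\<exists>\<^sub>F k in sequentially. u + t k *\<^sub>R \<omega> k \<in> C j"
    unfolding frequently_bex_finite_distrib[OF finite_lessThan] by auto
  then have "infinite {k. u + t k *\<^sub>R \<omega> k \<in> C j}"
    using frequently_cofinite[where 'a = nat] unfolding cofinite_eq_sequentially by simp
  then obtain r :: "nat \<Rightarrow> nat" where r: "strict_mono r" "\<And>k. u + t (r k) *\<^sub>R \<omega> (r k) \<in> C j"
    using infinite_enumerate[of "{k. u + t k *\<^sub>R \<omega> k \<in> C j}"] by auto
  note pj = piece[OF j(1)]
  have lims: "(\<lambda>k. t (r k)) \<longlonglongrightarrow> 0" "(\<lambda>k. \<omega> (r k)) \<longlonglongrightarrow> w" "(\<lambda>k. v (r k)) \<longlonglongrightarrow> v'"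
    using t(2) lim filterlim_subseq[OF r(1)] by (auto intro: filterlim_compose)
  have "closed (C j)" using pj by (simp add: quad_piece_def polyhedron_imp_closed)
  moreover have "(\<lambda>k. u + t (r k) *\<^sub>R \<omega> (r k)) \<longlonglongrightarrow> u + 0 *\<^sub>R w"
    by (intro tendsto_intros lims)
  ultimately have "u + 0 *\<^sub>R w \<in> C j"
    using closed_sequentially[of "C j" "\<lambda>k. u + t (r k) *\<^sub>R \<omega> (r k)"] r(2) by simp
  then have u: "u \<in> C j" by simp
  have ray: "\<forall>\<^sub>F s in at_right 0. u + s *\<^sub>R w \<in> C j"
    using pj u r(2) t(1) lims(2)
    by (intro polyhedron_tangent_ray[where t = "\<lambda>k. t (r k)"]) (auto simp: quad_piece_def)
  have tang: "(Q j *v u + b j) \<bullet> w = y \<bullet> w" "w \<bullet> (Q j *v w) \<le> v' \<bullet> w"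
    by (rule subdifferential_tangent_quad_piece[where t = "\<lambda>k. t (r k)" and v = "\<lambda>k. v (r k)",
          OF pj u y r(2) yk t(1) lims])+
  show "dir_deriv h u w = ereal (y \<bullet> w)"
    using dir_derivs_quad_piece(1)[OF pj u ray] tang(1) by simp
  show "\<exists>q. dir_deriv2 h u w = ereal q \<and> q \<le> v' \<bullet> w"
    using dir_derivs_quad_piece(2)[OF pj u ray] tang(2) by blast
qed

text \<open>The subgradient inequality at \<open>u + t k *\<^sub>R \<omega> k\<close> is tested at \<open>u + (\<sigma> * t k) *\<^sub>R (p - u)\<close> and divided
  by \<open>(t k)\<^sup>2\<close>; then \<open>k\<close> tends to infinity and afterwards \<open>\<sigma>\<close> to 0.\<close>

lemma subdifferential_vertical_quad_piece:
  fixes h :: "real^'m \<Rightarrow> ereal"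
  assumes piece: "quad_piece h S Q b \<beta>" and u: "u \<in> S" and p: "p \<in> S"
    and y: "y \<in> subdifferential h u"
    and yk: "\<And>k. y + t k *\<^sub>R v k \<in> subdifferential h (u + t k *\<^sub>R \<omega> k)"
    and t: "\<And>k. 0 < t k" "t \<longlonglongrightarrow> 0" and lim: "\<omega> \<longlonglongrightarrow> 0" "v \<longlonglongrightarrow> v'"
    and crit: "(Q *v u + b) \<bullet> (p - u) = y \<bullet> (p - u)"
  shows "v' \<bullet> (p - u) \<le> 0"
proof -
  let ?e = "p - u"
  let ?q = "?e \<bullet> (Q *v ?e)"
  have sym: "transpose Q = Q" using piece by (simp add: quad_piece_def)
  have bound: "v' \<bullet> ?e \<le> \<sigma> / 2 * ?q" if \<sigma>: "\<sigma> > 0" for \<sigma>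
  proof -
    have "\<forall>\<^sub>F k in sequentially. \<sigma> * t k < 1"
      using order_tendstoD(2)[OF tendsto_mult[OF tendsto_const t(2)], of \<sigma> 1] by simp
    then have "\<forall>\<^sub>F k in sequentially. \<sigma> * (v k \<bullet> ?e) - v k \<bullet> \<omega> k \<le> \<sigma>\<^sup>2 / 2 * ?q"
    proof (rule eventually_mono)
      fix k assume st: "\<sigma> * t k < 1"
      define s where "s = \<sigma> * t k"
      have s: "0 < s" "s < 1" using st \<sigma> t(1)[of k] by (auto simp: s_def)
      have "convex S" using piece by (simp add: quad_piece_def polyhedron_imp_convex)
      then have "(1 - s) *\<^sub>R u + s *\<^sub>R p \<in> S" using u p s by (intro convexD) auto
      moreover have "(1 - s) *\<^sub>R u + s *\<^sub>R p = u + s *\<^sub>R ?e" by (simp add: algebra_simps)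
      ultimately have S: "u + s *\<^sub>R ?e \<in> S" by simp
      \<comment> \<open>The shifted point may lie in any piece, so no formula for its value
        \<open>a\<close> is at hand; adding the subgradient inequalities at the shifted point and at
        \<open>u\<close> eliminates it.\<close>
      obtain a where a: "h (u + t k *\<^sub>R \<omega> k) = ereal a"
        using subdifferential_finite[OF yk] by blast
      have "a + (y + t k *\<^sub>R v k) \<bullet> (u + s *\<^sub>R ?e - (u + t k *\<^sub>R \<omega> k)) \<le> quad Q b \<beta> (u + s *\<^sub>R ?e)"
        using S piece by (intro subdifferential_ineq[OF yk a]) (simp add: quad_piece_def)
      moreover have "quad Q b \<beta> u + y \<bullet> (u + t k *\<^sub>R \<omega> k - u) \<le> a"
        using u piece by (intro subdifferential_ineq[OF y _ a]) (simp add: quad_piece_def)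
      ultimately have "(y + t k *\<^sub>R v k) \<bullet> (s *\<^sub>R ?e - t k *\<^sub>R \<omega> k) + y \<bullet> (t k *\<^sub>R \<omega> k)
          \<le> s * (y \<bullet> ?e) + s\<^sup>2 / 2 * ?q"
        unfolding quad_along_ray[OF sym] crit by simp
      moreover have "(y + t k *\<^sub>R v k) \<bullet> (s *\<^sub>R ?e - t k *\<^sub>R \<omega> k) + y \<bullet> (t k *\<^sub>R \<omega> k) =
          s * (y \<bullet> ?e) + (t k)\<^sup>2 * (\<sigma> * (v k \<bullet> ?e) - v k \<bullet> \<omega> k)"
        unfolding s_def by (simp only: inner_add_left inner_diff_right inner_scaleR_left
            inner_scaleR_right) (simp add: power2_eq_square algebra_simps)
      moreover have "s\<^sup>2 / 2 * ?q = (t k)\<^sup>2 * (\<sigma>\<^sup>2 / 2 * ?q)"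
        unfolding s_def by (simp add: power_mult_distrib)
      ultimately have "(t k)\<^sup>2 * (\<sigma> * (v k \<bullet> ?e) - v k \<bullet> \<omega> k) \<le> (t k)\<^sup>2 * (\<sigma>\<^sup>2 / 2 * ?q)"
        by linarith
      then show "\<sigma> * (v k \<bullet> ?e) - v k \<bullet> \<omega> k \<le> \<sigma>\<^sup>2 / 2 * ?q"
        using t(1)[of k] by (simp add: mult_le_cancel_left)
    qed
    moreover have "(\<lambda>k. \<sigma> * (v k \<bullet> ?e) - v k \<bullet> \<omega> k) \<longlonglongrightarrow> \<sigma> * (v' \<bullet> ?e) - v' \<bullet> 0"
      by (intro tendsto_intros lim)
    ultimately have "\<sigma> * (v' \<bullet> ?e) - v' \<bullet> 0 \<le> \<sigma>\<^sup>2 / 2 * ?q"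
      by (intro tendsto_upperbound) auto
    then have "\<sigma> * (v' \<bullet> ?e) \<le> \<sigma> * (\<sigma> / 2 * ?q)" by (simp add: power2_eq_square)
    then show ?thesis using \<sigma> by (simp add: mult_le_cancel_left)
  qed
  have "\<forall>\<^sub>F \<sigma> in at_right 0. v' \<bullet> ?e \<le> \<sigma> / 2 * ?q"
    using eventually_at_right_less[of "0::real"] by (rule eventually_mono) (rule bound)
  moreover have "((\<lambda>\<sigma>. \<sigma> / 2 * ?q) \<longlongrightarrow> 0 / 2 * ?q) (at_right 0)" by (intro tendsto_intros) auto
  ultimately have "v' \<bullet> ?e \<le> 0 / 2 * ?q" by (intro tendsto_lowerbound) auto
  then show ?thesis by simp
qed

section \<open>Subgradients of convex functions from slopes on the pieces\<close>

lemma econvex_along_segment: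
  assumes "econvex h" "h u = ereal a" "h p = ereal c" "0 \<le> s" "s \<le> 1"
  shows "h (u + s *\<^sub>R (p - u)) \<le> ereal (a + s * (c - a))"
proof -
  have "(1 - s) *\<^sub>R (u, a) + s *\<^sub>R (p, c) \<in> {(x, r). h x \<le> ereal r}"
    using assms(1) unfolding econvex_def by (rule convexD) (use assms in auto)
  moreover have "(1 - s) *\<^sub>R (u, a) + s *\<^sub>R (p, c) = (u + s *\<^sub>R (p - u), a + s * (c - a))"
    by (simp add: scaleR_diff_left scaleR_diff_right left_diff_distrib right_diff_distrib)
  ultimately show ?thesis by simp
qed

text \<open>By convexity the chord from \<open>u\<close> to \<open>p\<close> dominates
  \<open>h\<close>, so \<open>h p - h u\<close> is at least the slope of \<open>h\<close> at
  \<open>u\<close> towards \<open>p\<close>. This is the slope of a piece that the segment meets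
  arbitrarily close to \<open>u\<close>, and \<open>slope\<close> compares it with \<open>z\<close>.
  Hence tests near \<open>u\<close> suffice.\<close>

lemma subdifferential_if_local_pieces:
  fixes h :: "real^'m \<Rightarrow> ereal"
  assumes "proper_fun h" "econvex h" and hu: "h u = ereal a"
    and dom: "edom h = (\<Union>j<N::nat. C j)"
    and piece: "\<And>j. j < N \<Longrightarrow> quad_piece h (C j) (Q j) (b j) (\<beta> j)"
    and \<delta>: "\<delta> > 0"
    and slope: "\<And>j p. j < N \<Longrightarrow> u \<in> C j \<Longrightarrow> p \<in> C j \<inter> ball u \<delta> \<Longrightarrow>
      0 \<le> (Q j *v u + b j - z) \<bullet> (p - u)"
  shows "z \<in> subdifferential h u"
proof -
  have "h u + ereal (z \<bullet> (p - u)) \<le> h p" for p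
  proof (cases "h p")
    case MInf
    then show ?thesis using assms(1) by (simp add: proper_fun_def)
  next
    case PInf
    then show ?thesis by simp
  next
    case (real c)
    let ?e = "p - u"
    have seg: "h (u + s *\<^sub>R ?e) \<le> ereal (a + s * (c - a))" if "0 < s" "s < 1" for s
      using econvex_along_segment[OF assms(2) hu real] that by simp
    have s01: "\<forall>\<^sub>F s::real in at_right 0. 0 < s \<and> s < 1"
      by (auto simp: eventually_at_right_field intro!: exI[of _ 1])
    have "\<forall>\<^sub>F s in at_right 0. \<exists>j\<in>{..<N}. u + s *\<^sub>R ?e \<in> C j"
      using s01
    proof (rule eventually_mono)
      fix s :: real assume "0 < s \<and> s < 1"
      then have "u + s *\<^sub>R ?e \<in> edom h" using seg[of s] by (auto simp: edom_def less_top[symmetric])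
      then show "\<exists>j\<in>{..<N}. u + s *\<^sub>R ?e \<in> C j" using dom by auto
    qed
    then have "\<exists>\<^sub>F s in at_right 0. \<exists>j\<in>{..<N}. u + s *\<^sub>R ?e \<in> C j"
      by (intro eventually_frequently) auto
    then obtain j where j: "j < N" "\<exists>\<^sub>F s in at_right 0. u + s *\<^sub>R ?e \<in> C j"
      unfolding frequently_bex_finite_distrib[OF finite_lessThan] by auto
    note pj = piece[OF j(1)]
    have lim: "((\<lambda>s. u + s *\<^sub>R ?e) \<longlongrightarrow> u) (at_right 0)"
      by (rule tendsto_eq_intros refl | simp)+
    have u: "u \<in> C j"
    proof (rule ccontr)
      assume "u \<notin> C j"
      moreover have "open (- C j)"
        using pj by (simp add: quad_piece_def polyhedron_imp_closed open_Compl)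
      ultimately have "\<forall>\<^sub>F s in at_right 0. u + s *\<^sub>R ?e \<in> - C j"
        using lim by (intro topological_tendstoD) auto
      then show False using j(2) by (simp add: frequently_def)
    qed
    have near: "\<forall>\<^sub>F s in at_right 0. u + s *\<^sub>R ?e \<in> ball u \<delta>"
      using lim \<delta> by (intro topological_tendstoD) auto
    let ?g = "Q j *v u + b j"
    have slope': "z \<bullet> ?e \<le> ?g \<bullet> ?e"
    proof -
      have "\<exists>\<^sub>F s in at_right 0. u + s *\<^sub>R ?e \<in> C j \<and> (u + s *\<^sub>R ?e \<in> ball u \<delta> \<and> 0 < s \<and> s < 1)"
        by (rule frequently_eventually_frequently[OF j(2) eventually_conj[OF near s01]])
      then obtain s where s: "u + s *\<^sub>R ?e \<in> C j \<inter> ball u \<delta>" "0 < s"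
        using frequently_ex by blast
      have "0 \<le> s * ((?g - z) \<bullet> ?e)" using slope[OF j(1) u s(1)] by simp
      then show ?thesis using s(2) by (simp add: zero_le_mult_iff inner_diff_left)
    qed
    have "?g \<bullet> ?e \<le> c - a"
    proof (rule ccontr)
      assume "\<not> ?g \<bullet> ?e \<le> c - a"
      moreover have "((\<lambda>s. ?g \<bullet> ?e + s / 2 * (?e \<bullet> (Q j *v ?e))) \<longlongrightarrow>
          ?g \<bullet> ?e + 0 / 2 * (?e \<bullet> (Q j *v ?e))) (at_right 0)" by (intro tendsto_intros) auto
      ultimately have "\<forall>\<^sub>F s in at_right 0. c - a < ?g \<bullet> ?e + s / 2 * (?e \<bullet> (Q j *v ?e))"
        by (intro order_tendstoD) auto
      from frequently_eventually_conj[OF j(2) eventually_conj[OF s01 this]]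
      obtain s where s: "u + s *\<^sub>R ?e \<in> C j" "0 < s" "s < 1"
          "c - a < ?g \<bullet> ?e + s / 2 * (?e \<bullet> (Q j *v ?e))"
        using frequently_ex by blast
      have "a = quad (Q j) (b j) (\<beta> j) u" using pj u hu by (simp add: quad_piece_def)
      moreover have "quad (Q j) (b j) (\<beta> j) (u + s *\<^sub>R ?e) \<le> a + s * (c - a)"
        using seg[of s] s pj by (simp add: quad_piece_def)
      moreover have "transpose (Q j) = Q j" using pj by (simp add: quad_piece_def)
      ultimately have "s * (?g \<bullet> ?e + s / 2 * (?e \<bullet> (Q j *v ?e))) \<le> s * (c - a)"
        by (simp only: quad_along_ray) (simp add: power2_eq_square algebra_simps)
      then show False using s by (simp add: mult_le_cancel_left)
    qed
    then show ?thesis using slope' hu real by simp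
  qed
  then show ?thesis using hu by (simp add: subdifferential_def)
qed

text \<open>Cutting each piece down to a box makes it a polytope, so that only its finitely many vertices
  restrict \<open>s\<close>.\<close>

lemma subdifferential_vertical_tangent:
  fixes h :: "real^'m \<Rightarrow> ereal"
  assumes "plq h" "econvex h" and y: "y \<in> subdifferential h u"
    and yk: "\<And>k. y + t k *\<^sub>R v k \<in> subdifferential h (u + t k *\<^sub>R \<omega> k)"
    and t: "\<And>k. 0 < t k" "t \<longlonglongrightarrow> 0" and lim: "\<omega> \<longlonglongrightarrow> 0" "v \<longlonglongrightarrow> v'"
  shows "\<exists>s>0. y + s *\<^sub>R v' \<in> subdifferential h u"
proof -
  obtain N :: nat and C Q b \<beta> where dom: "edom h = (\<Union>j<N. C j)"
    and piece: "\<And>j. j < N \<Longrightarrow> quad_piece h (C j) (Q j) (b j) (\<beta> j)"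
    by (rule plqE[OF assms(1)]) (rule that; assumption)
  obtain a where hu: "h u = ereal a" using subdifferential_finite[OF y] by blast
  \<comment> \<open>The box contains the unit ball around \<open>u\<close>, so cutting the pieces
    does not affect the local test with radius 1 below.\<close>
  obtain r where r: "ball u 1 \<subseteq> cbox (- r) r"
    using bounded_subset_cbox_symmetric[OF bounded_ball] by blast
  define K where "K = cbox (- r) r"
  have "\<exists>V. finite V \<and> C j \<inter> K = convex hull V" if "j < N" for j
  proof -
    have "polyhedron (C j \<inter> K)"
      using piece[OF that] by (simp add: quad_piece_def K_def polytope_imp_polyhedron polytope_interval)
    moreover have "bounded (C j \<inter> K)" unfolding K_def by (simp add: bounded_Int)
    ultimately have "polytope (C j \<inter> K)" by (simp add: polytope_eq_bounded_polyhedron)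
    then show ?thesis by (simp add: polytope_def)
  qed
  then obtain V where V: "\<And>j. j < N \<Longrightarrow> finite (V j)" "\<And>j. j < N \<Longrightarrow> C j \<inter> K = convex hull (V j)"
    by metis
  let ?g = "\<lambda>j. Q j *v u + b j - y"
  let ?P = "\<lambda>s j p. u \<in> C j \<longrightarrow> 0 \<le> (?g j - s *\<^sub>R v') \<bullet> (p - u)"
  have vertex: "\<forall>\<^sub>F s in at_right 0. ?P s j p" if j: "j < N" and p: "p \<in> V j" for j p
  proof (cases "u \<in> C j")
    case True
    have pC: "p \<in> C j" using V(2)[OF j] p hull_subset[of "V j" convex] by auto
    note pj = piece[OF j]
    have nonneg: "0 \<le> ?g j \<bullet> (p - u)" by (rule subdifferential_normal[OF pj True pC y])
    \<comment> \<open>A vertex with zero slope admits every positive \<open>s\<close>, since then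
      \<open>v' \<bullet> (p - u) \<le> 0\<close>; one with positive slope tolerates a small
      perturbation.\<close>
    show ?thesis
    proof (cases "?g j \<bullet> (p - u) = 0")
      case z: True
      then have "v' \<bullet> (p - u) \<le> 0"
        by (intro subdifferential_vertical_quad_piece[OF pj True pC y yk t lim])
          (simp add: inner_diff_left)
      then show ?thesis
        by (intro eventually_mono[OF eventually_at_right_less[of "0::real"]])
          (simp add: inner_diff_left[of "?g j"] z mult_le_0_iff)
    next
      case False
      have "((\<lambda>s. (?g j - s *\<^sub>R v') \<bullet> (p - u)) \<longlongrightarrow> (?g j - 0 *\<^sub>R v') \<bullet> (p - u)) (at_right 0)"
        by (intro tendsto_intros)
      moreover have "0 < (?g j - 0 *\<^sub>R v') \<bullet> (p - u)" using nonneg False by simp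
      ultimately have "\<forall>\<^sub>F s in at_right 0. 0 < (?g j - s *\<^sub>R v') \<bullet> (p - u)"
        by (rule order_tendstoD)
      then show ?thesis by (rule eventually_mono) simp
    qed
  qed simp
  have "\<forall>\<^sub>F s in at_right 0. \<forall>j\<in>{..<N}. \<forall>p\<in>V j. ?P s j p"
    using vertex V(1) by (simp add: eventually_ball_finite_distrib)
  then have "\<forall>\<^sub>F s in at_right 0. (\<forall>j\<in>{..<N}. \<forall>p\<in>V j. ?P s j p) \<and> 0 < s"
    using eventually_at_right_less by (rule eventually_conj)
  from eventually_happens'[OF trivial_limit_at_right_real this]
  obtain s where s: "0 < s" "\<And>j p. j < N \<Longrightarrow> p \<in> V j \<Longrightarrow> ?P s j p" by auto
  have "y + s *\<^sub>R v' \<in> subdifferential h u"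
  proof (rule subdifferential_if_local_pieces[OF _ assms(2) hu dom piece zero_less_one])
    show "proper_fun h" using assms(1) by (simp add: plq_def)
    fix j p assume j: "j < N" and u: "u \<in> C j" and p: "p \<in> C j \<inter> ball u 1"
    \<comment> \<open>The condition on \<open>p\<close> is affine, so it passes from the vertices to
      their convex hull.\<close>
    let ?H = "{p. (?g j - s *\<^sub>R v') \<bullet> u \<le> (?g j - s *\<^sub>R v') \<bullet> p}"
    have "V j \<subseteq> ?H" using s(2)[OF j] u by (auto simp: inner_diff_right)
    moreover have "convex ?H"
      using convex_halfspace_ge[of "(?g j - s *\<^sub>R v') \<bullet> u" "?g j - s *\<^sub>R v'"] by simp
    ultimately have "convex hull (V j) \<subseteq> ?H" by (rule hull_minimal)
    then have "p \<in> ?H" using p r[folded K_def] V(2)[OF j] by blast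
    then show "0 \<le> (Q j *v u + b j - (y + s *\<^sub>R v')) \<bullet> (p - u)"
      by (simp add: inner_diff_right diff_diff_eq)
  qed
  then show ?thesis using s(1) by blast
qed

text \<open>The subgradient inequality says that the supremum defining \<open>conjugate h y\<close>
  is attained at \<open>u\<close>. The affine function \<open>w \<bullet> u - a\<close> of
  \<open>w\<close>, which lies below the conjugate everywhere, therefore touches it at
  \<open>y\<close>.\<close>

lemma subdifferential_conjugate:
  assumes "y \<in> subdifferential h u"
  shows "u \<in> subdifferential (conjugate h) y"
proof -
  obtain a where a: "h u = ereal a" by (rule subdifferential_finite[OF assms])
  have "ereal (y \<bullet> w) - h w \<le> ereal (y \<bullet> u - a)" for w
  proof (cases "h w")
    case (real b)
    then show ?thesis using subdifferential_ineq[OF assms a real] by (simp add: inner_diff_right)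
  next
    case MInf
    have "h u + ereal (y \<bullet> (w - u)) \<le> h w" using assms by (simp add: subdifferential_def)
    then show ?thesis using MInf a by simp
  qed simp
  moreover have lower: "ereal (w \<bullet> u - a) \<le> conjugate h w" for w
    unfolding conjugate_def by (rule SUP_upper2[of u]) (simp_all add: a)
  ultimately have y: "conjugate h y = ereal (y \<bullet> u - a)"
    unfolding conjugate_def by (intro antisym SUP_least lower[unfolded conjugate_def]) auto
  show ?thesis
    using lower unfolding subdifferential_def y by (simp add: inner_diff_right inner_commute)
qed

subsection \<open>The gradient of the Lagrangian\<close>

text \<open>Strict differentiability at \<open>a\<close>: the error is small relative to
  \<open>w k - z k\<close>, even when both points are much farther from \<open>a\<close> than from
  each other. Continuity of the derivative in each direction controls its operator norm, through the
  sum \<open>\<sigma>\<close> over the finite basis.\<close>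

lemma strictly_differentiable_seq:
  fixes f :: "'a::euclidean_space \<Rightarrow> 'b::real_normed_vector"
  assumes deriv: "\<And>z. (f has_derivative f' z) (at z)"
    and cont: "\<And>e. isCont (\<lambda>z. f' z e) a"
    and z: "z \<longlonglongrightarrow> a" and w: "w \<longlonglongrightarrow> a"
  shows "(\<lambda>k. norm (f (w k) - f (z k) - f' (z k) (w k - z k))) \<in> o(\<lambda>k. norm (w k - z k))"
proof (rule landau_o.smallI)
  fix \<epsilon> :: real assume \<epsilon>: "\<epsilon> > 0"
  define \<sigma> where "\<sigma> z = (\<Sum>i\<in>Basis. norm (f' z i - f' a i))" for z
  have lin: "linear (f' z)" for z using deriv by (rule has_derivative_linear)
  have op: "norm (f' z e - f' a e) \<le> \<sigma> z * norm e" for z e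
  proof -
    interpret D: linear "\<lambda>e. f' z e - f' a e" by (intro linear_compose_sub lin)
    have "f' z e - f' a e = (\<Sum>i\<in>Basis. (e \<bullet> i) *\<^sub>R (f' z i - f' a i))"
      using D.sum[of "\<lambda>i. (e \<bullet> i) *\<^sub>R i" Basis] by (simp add: D.scaleR euclidean_representation)
    also have "norm \<dots> \<le> (\<Sum>i\<in>Basis. norm e * norm (f' z i - f' a i))"
      by (intro sum_norm_le) (simp add: mult_right_mono Basis_le_norm)
    finally show ?thesis by (simp add: \<sigma>_def sum_distrib_left mult.commute)
  qed
  have "isCont \<sigma> a" unfolding \<sigma>_def by (intro continuous_intros cont)
  then have "\<sigma> \<midarrow>a\<rightarrow> 0" by (simp add: isCont_def \<sigma>_def)
  then obtain \<delta> where \<delta>: "\<delta> > 0" "\<And>z. z \<noteq> a \<Longrightarrow> norm (z - a) < \<delta> \<Longrightarrow> norm (\<sigma> z - 0) < \<epsilon> / 2"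
    using LIM_D[of \<sigma> 0 a "\<epsilon> / 2"] \<epsilon> by (metis half_gt_zero)
  have small: "\<sigma> z \<le> \<epsilon> / 2" if "z \<in> ball a \<delta>" for z
  proof (cases "z = a")
    case True
    then show ?thesis using \<epsilon> by (simp add: \<sigma>_def)
  next
    case False
    then show ?thesis using \<delta>(2)[of z] that by (simp add: dist_norm norm_minus_commute)
  qed
  have bound: "norm (f w - f z - f' z (w - z)) \<le> \<epsilon> * norm (w - z)"
    if "z \<in> ball a \<delta>" "w \<in> ball a \<delta>" for z w
  proof -
    \<comment> \<open>Mean value inequality for \<open>f\<close> minus its linear part at
      \<open>z\<close>: the derivative at \<open>x\<close> is \<open>f' x - f' z\<close>, and on the
      ball both terms are within \<open>\<epsilon> / 2\<close> of \<open>f' a\<close>.\<close>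
    have "norm ((f w - f' z w) - (f z - f' z z)) \<le> \<epsilon> * norm (w - z)"
    proof (rule differentiable_bound[of "ball a \<delta>" _ "\<lambda>x e. f' x e - f' z e"])
      fix x assume x: "x \<in> ball a \<delta>"
      have "(f' z has_derivative f' z) (at x within ball a \<delta>)"
        using deriv has_derivative_bounded_linear bounded_linear_imp_has_derivative by blast
      then show "((\<lambda>x. f x - f' z x) has_derivative (\<lambda>e. f' x e - f' z e)) (at x within ball a \<delta>)"
        by (intro has_derivative_diff has_derivative_at_withinI[OF deriv])
      have "norm (f' x e - f' z e) \<le> \<epsilon> * norm e" for e
      proof -
        have "norm (f' x e - f' z e) \<le> norm (f' x e - f' a e) + norm (f' z e - f' a e)"
          using norm_triangle_ineq4[of "f' x e - f' a e" "f' z e - f' a e"] by simp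
        also have "\<dots> \<le> \<epsilon> / 2 * norm e + \<epsilon> / 2 * norm e"
          using small[OF x] small[OF that(1)]
          by (intro add_mono order_trans[OF op] mult_right_mono) auto
        finally show ?thesis by simp
      qed
      then show "onorm (\<lambda>e. f' x e - f' z e) \<le> \<epsilon>" using \<epsilon> by (intro onorm_bound) auto
    qed (use that in auto)
    moreover have "f w - f' z w - (f z - f' z z) = f w - f z - f' z (w - z)"
      using linear_diff[OF lin, of z w z] by (simp add: algebra_simps)
    ultimately show ?thesis by simp
  qed
  have "\<forall>\<^sub>F k in sequentially. z k \<in> ball a \<delta>" "\<forall>\<^sub>F k in sequentially. w k \<in> ball a \<delta>"
    using topological_tendstoD[OF z open_ball] topological_tendstoD[OF w open_ball] \<delta>(1)
    by (meson centre_in_ball)+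
  then show "\<forall>\<^sub>F k in sequentially. norm (norm (f (w k) - f (z k) - f' (z k) (w k - z k)))
      \<le> \<epsilon> * norm (norm (w k - z k))"
    by eventually_elim (simp add: bound)
qed

text \<open>A Frechet derivative controls difference quotients along varying directions too: the
  remainder is of smaller order than \<open>t k * norm (\<zeta> k)\<close>, and convergent
  directions stay bounded.\<close>

lemma has_derivative_along_seq:
  assumes "(f has_derivative f') (at a)"
    and t: "\<And>k. 0 < t k" "t \<longlonglongrightarrow> 0" and \<zeta>: "\<zeta> \<longlonglongrightarrow> \<zeta>'"
  shows "(\<lambda>k. (f (a + t k *\<^sub>R \<zeta> k) - f a) /\<^sub>R t k) \<longlonglongrightarrow> f' \<zeta>'"
proof -
  have bl: "bounded_linear f'" using assms(1) by (rule has_derivative_bounded_linear)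
  define R where "R k = (f (a + t k *\<^sub>R \<zeta> k) - f a) /\<^sub>R t k - f' (\<zeta> k)" for k
  have "R \<longlonglongrightarrow> 0"
  proof (rule tendstoI)
    fix \<epsilon> :: real assume \<epsilon>: "\<epsilon> > 0"
    define M where "M = norm \<zeta>' + 1"
    have M: "M > 0" unfolding M_def by (smt (verit) norm_ge_zero)
    have "\<epsilon> / (2 * M) > 0" using \<epsilon> M by simp
    then obtain \<delta> where \<delta>: "\<delta> > 0" "\<And>y. norm (y - a) < \<delta> \<Longrightarrow>
        norm (f y - f a - f' (y - a)) \<le> \<epsilon> / (2 * M) * norm (y - a)"
      using assms(1) unfolding has_derivative_at_alt by blast
    have "(\<lambda>k. norm (t k *\<^sub>R \<zeta> k)) \<longlonglongrightarrow> norm (0 *\<^sub>R \<zeta>')" by (intro tendsto_intros t \<zeta>)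
    then have "\<forall>\<^sub>F k in sequentially. norm (t k *\<^sub>R \<zeta> k) < \<delta>"
      using \<delta>(1) by (intro order_tendstoD) auto
    moreover have "\<forall>\<^sub>F k in sequentially. norm (\<zeta> k) < M"
      using tendsto_norm[OF \<zeta>] by (intro order_tendstoD) (auto simp: M_def)
    ultimately show "\<forall>\<^sub>F k in sequentially. dist (R k) 0 < \<epsilon>"
    proof eventually_elim
      case (elim k)
      have "t k *\<^sub>R R k = f (a + t k *\<^sub>R \<zeta> k) - f a - f' (t k *\<^sub>R \<zeta> k)"
        using t(1)[of k] bounded_linear.linear[OF bl]
        by (simp add: R_def scaleR_diff_right linear_scale)
      then have "t k * norm (R k) \<le> \<epsilon> / (2 * M) * norm (t k *\<^sub>R \<zeta> k)"
        using \<delta>(2)[of "a + t k *\<^sub>R \<zeta> k"] elim(1) t(1)[of k]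
        by (metis abs_of_pos add_diff_cancel_left' norm_scaleR)
      then have "t k * norm (R k) \<le> t k * (\<epsilon> / (2 * M) * norm (\<zeta> k))"
        using t(1)[of k] by (simp add: mult.assoc mult.left_commute[of \<epsilon>])
      then have "norm (R k) \<le> \<epsilon> / (2 * M) * norm (\<zeta> k)"
        using t(1)[of k] by (simp only: mult_le_cancel_left_pos)
      also have "\<dots> \<le> \<epsilon> / (2 * M) * M" using elim(2) \<epsilon> M by (intro mult_left_mono) auto
      also have "\<dots> < \<epsilon>" using \<epsilon> M by simp
      finally show ?case by simp
    qed
  qed
  then have "(\<lambda>k. R k + f' (\<zeta> k)) \<longlonglongrightarrow> 0 + f' \<zeta>'"
    by (intro tendsto_add bounded_linear.tendsto[OF bl \<zeta>])
  then show ?thesis by (simp add: R_def)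
qed

section \<open>Matrix form of the derivatives of the Lagrangian\<close>

lemma has_derivative_vec_lambda:
  fixes f :: "'i::finite \<Rightarrow> 'a::real_normed_vector \<Rightarrow> real"
  assumes "\<And>i. (f i has_derivative f' i) (at a)"
  shows "((\<lambda>x. \<chi> i. f i x) has_derivative (\<lambda>e. \<chi> i. f' i e)) (at a)"
proof -
  have "(\<chi> i. g i) = (\<Sum>i\<in>UNIV. g i *\<^sub>R axis i (1::real))" for g :: "'i \<Rightarrow> real"
    by (simp add: vec_eq_iff axis_def if_distrib sum.delta' cong: if_cong)
  then show ?thesis by (auto intro!: derivative_eq_intros assms)
qed

lemma inner_transpose_matrix:
  fixes A :: "real^'n^'m"
  shows "(transpose A *v y) \<bullet> d = y \<bullet> (A *v d)"
  by (simp add: dot_lmul_matrix transpose_matrix_vector)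

text \<open>The first component of \<open>ge_map c\<close>: the gradient in \<open>x\<close> of
  \<open>y \<bullet> c x\<close>, taken as a function of the pair so that \<open>x\<close> and
  \<open>y\<close> can vary together.\<close>

definition lagrangian_grad ::
  "(real^'n \<Rightarrow> real^'m) \<Rightarrow> (real^'n) \<times> (real^'m) \<Rightarrow> real^'n" where
  "lagrangian_grad c z = transpose (jac c (fst z)) *v snd z"

definition lagrangian_grad_deriv ::
  "(real^'n \<Rightarrow> real^'m) \<Rightarrow> (real^'n) \<times> (real^'m) \<Rightarrow> (real^'n) \<times> (real^'m) \<Rightarrow> real^'n" where
  "lagrangian_grad_deriv c z e =
     hessian (scalarized (snd z) c) (fst z) *v fst e + transpose (jac c (fst z)) *v snd e"

lemma jac_has_derivative:
  assumes "(c has_derivative D) (at x)"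
  shows "jac c x *v d = D d"
proof -
  have "(c has_derivative (\<lambda>d. jac c x *v d)) (at x)"
    using assms by (simp add: jacobian_works[symmetric] differentiable_def) blast
  then show ?thesis using has_derivative_unique[OF assms] by metis
qed

text \<open>Translates the abstract derivatives \<open>D\<close> and \<open>E\<close> of
  \<open>C2_smooth\<close> into Jacobian and Hessian matrices. Continuity is stated direction by
  direction, the form that \<open>strictly_differentiable_seq\<close> takes.\<close>

lemma C2_smooth_lagrangian:
  fixes c :: "real^'n \<Rightarrow> real^'m"
  assumes "C2_smooth c"
  shows C2_smooth_has_derivative: "(c has_derivative (*v) (jac c x)) (at x)"
    and C2_smooth_isCont_jac: "isCont (\<lambda>x. jac c x *v d) x"
    and C2_smooth_isCont_transpose_jac: "isCont (\<lambda>x. transpose (jac c x) *v y) x"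
    and C2_smooth_isCont_hessian:
      "isCont (\<lambda>z. hessian (scalarized (snd z) c) (fst z) *v d) z"
    and lagrangian_grad_has_derivative:
      "(lagrangian_grad c has_derivative lagrangian_grad_deriv c z) (at z)"
proof -
  obtain D where D: "\<And>x. (c has_derivative blinfun_apply (D x)) (at x)" and "C1_smooth D"
    using assms unfolding C2_smooth_def by blast
  then obtain E where E: "\<And>x. (D has_derivative blinfun_apply (E x)) (at x)"
    and contE: "continuous_on UNIV E" unfolding C1_smooth_def by blast
  have contD: "continuous_on UNIV D"
    using E by (meson continuous_at_imp_continuous_on has_derivative_continuous)
  have jac: "jac c x *v d = D x d" for x d by (rule jac_has_derivative[OF D])
  have tjac: "transpose (jac c x) *v y = (\<chi> i. y \<bullet> D x (axis i 1))" for x y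
    using inner_transpose_matrix[of "jac c x" y "axis _ 1"]
    by (simp add: vec_eq_iff jac inner_axis)
  have G: "lagrangian_grad c = (\<lambda>z. \<chi> i. snd z \<bullet> D (fst z) (axis i 1))"
    unfolding lagrangian_grad_def[abs_def] tjac ..
  have "((\<lambda>z. D (fst z)) has_derivative (\<lambda>e. E (fst z) (fst e))) (at z)" for z :: "(real^'n) \<times> (real^'m)"
    by (rule has_derivative_compose[OF _ E]) (auto intro!: derivative_eq_intros)
  then have Dz: "((\<lambda>z. D (fst z) a) has_derivative (\<lambda>e. E (fst z) (fst e) a)) (at z)"
    for a and z :: "(real^'n) \<times> (real^'m)"
    by (rule bounded_linear.has_derivative[OF blinfun.bounded_linear_left])
  have dG: "(lagrangian_grad c has_derivative
      (\<lambda>e. \<chi> i. snd z \<bullet> E (fst z) (fst e) (axis i 1) + snd e \<bullet> D (fst z) (axis i 1))) (at z)" for z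
    unfolding G
    by (intro has_derivative_vec_lambda has_derivative_inner has_derivative_snd[OF has_derivative_ident] Dz)
  \<comment> \<open>This is \<open>lagrangian_grad\<close> with \<open>y\<close> frozen, so the
    Hessian can be read off the joint derivative at increments \<open>(d, 0)\<close>.\<close>
  have grad: "grad (scalarized y c) = (\<lambda>x. lagrangian_grad c (x, y))" for y
  proof
    fix x
    have "((\<lambda>x. y \<bullet> c x) has_derivative (\<lambda>d. y \<bullet> D x d)) (at x)"
      by (intro has_derivative_inner_right D)
    then show "grad (scalarized y c) x = lagrangian_grad c (x, y)"
      unfolding grad_def scalarized_def G by (simp add: frechet_derivative_at[symmetric])
  qed
  have hess: "hessian (scalarized y c) x *v d = (\<chi> i. y \<bullet> E x d (axis i 1))" for x y d
  proof -
    have "((\<lambda>x. lagrangian_grad c (x, y)) has_derivative (\<lambda>d. \<chi> i. y \<bullet> E x d (axis i 1))) (at x)"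
      using has_derivative_compose[where f = "\<lambda>x. (x, y)" and f' = "\<lambda>d. (d, 0)" and x = x
          and s = UNIV, OF _ dG]
      by (simp add: has_derivative_Pair)
    then show ?thesis unfolding hessian_def grad by (rule jac_has_derivative)
  qed
  show "(c has_derivative (*v) (jac c x)) (at x)"
    using D[of x] by (simp add: jac[abs_def])
  show "isCont (\<lambda>x. jac c x *v d) x"
    using D[of x] E[of x]
    unfolding jac by (intro continuous_intros has_derivative_continuous)
  show "isCont (\<lambda>x. transpose (jac c x) *v y) x"
  proof -
    have "continuous_on UNIV (\<lambda>x. transpose (jac c x) *v y)"
      unfolding tjac by (intro continuous_intros contD)
    then show ?thesis by (simp add: continuous_on_eq_continuous_at)
  qed
  show "isCont (\<lambda>z. hessian (scalarized (snd z) c) (fst z) *v d) z"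
  proof -
    have "continuous_on UNIV (\<lambda>z::(real^'n) \<times> (real^'m). E (fst z))"
      by (intro continuous_on_compose2[OF contE] continuous_intros) auto
    then have "continuous_on UNIV (\<lambda>z. hessian (scalarized (snd z) c) (fst z) *v d)"
      unfolding hess by (intro continuous_intros)
    then show ?thesis by (cases z) (simp add: continuous_on_eq_continuous_at)
  qed
  have "lagrangian_grad_deriv c z =
      (\<lambda>e. \<chi> i. snd z \<bullet> E (fst z) (fst e) (axis i 1) + snd e \<bullet> D (fst z) (axis i 1))"
    unfolding lagrangian_grad_deriv_def[abs_def] hess tjac by (simp add: fun_eq_iff vec_eq_iff)
  then show "(lagrangian_grad c has_derivative lagrangian_grad_deriv c z) (at z)"
    using dG by simp
qed

subsection \<open>Error bound and superlinear convergence\<close>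

text \<open>Strong metric subregularity of the generalized equation at its solution. The residual
  \<open>r\<close> sits in the argument of \<open>subdifferential h\<close> because the
  linearization error of \<open>c\<close> will appear there.\<close>

lemma kkt_error_bound:
  fixes h :: "real^'m \<Rightarrow> ereal" and c :: "real^'n \<Rightarrow> real^'m"
  assumes plq: "plq h" and conv: "econvex h" and C2: "C2_smooth c"
    and M: "multipliers h c xbar = {ybar}"
    and sosc: "\<And>d. d \<in> nonascent_dirs h c xbar \<Longrightarrow> d \<noteq> 0 \<Longrightarrow>
      dir_deriv2 h (c xbar) (jac c xbar *v d)
        + ereal (d \<bullet> (hessian (scalarized ybar c) xbar *v d)) > 0"
  shows "\<exists>\<kappa>>0. \<exists>\<delta>>0. \<forall>x y r. norm ((x, y) - (xbar, ybar)) < \<delta> \<longrightarrow>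
    y \<in> subdifferential h (c x + r) \<longrightarrow>
    norm ((x, y) - (xbar, ybar)) \<le> \<kappa> * (norm (lagrangian_grad c (x, y)) + norm r)"
proof (rule ccontr)
  let ?z = "(xbar, ybar)"
  assume "\<not> ?thesis"
  \<comment> \<open>Failure is used with \<open>\<kappa> = Suc n\<close> and
    \<open>\<delta> = 1 / Suc n\<close>: the latter drives the points to the solution, the former
    makes the residuals negligible against their distance from it.\<close>
  then have "\<exists>z r. norm (z - ?z) < 1 / real (Suc n) \<and> snd z \<in> subdifferential h (c (fst z) + r) \<and>
      real (Suc n) * (norm (lagrangian_grad c z) + norm r) < norm (z - ?z)" for n
    by (simp add: not_le)
  then obtain Z R where Z: "\<And>n. norm (Z n - ?z) < 1 / real (Suc n)"
    and sub: "\<And>n. snd (Z n) \<in> subdifferential h (c (fst (Z n)) + R n)"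
    and less: "\<And>n. real (Suc n) * (norm (lagrangian_grad c (Z n)) + norm (R n)) < norm (Z n - ?z)"
    by metis
  define T where "T n = norm (Z n - ?z)" for n
  have Tpos: "0 < T n" for n
    using le_less_trans[OF _ less[of n], of 0] by (simp add: T_def)
  have T0: "T \<longlonglongrightarrow> 0"
  proof (rule Lim_null_comparison)
    show "\<forall>\<^sub>F n in sequentially. norm (T n) \<le> 1 / real (Suc n)"
      using Z by (simp add: T_def less_imp_le)
    show "(\<lambda>n. 1 / real (Suc n)) \<longlonglongrightarrow> 0" by (rule LIMSEQ_Suc[OF lim_1_over_n])
  qed
  have sph: "\<forall>n. (Z n - ?z) /\<^sub>R T n \<in> sphere 0 1" using Tpos by (simp add: T_def)
  obtain \<zeta>' \<rho> where "\<zeta>' \<in> sphere 0 1" and \<rho>: "strict_mono \<rho>"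
    and conv\<zeta>: "((\<lambda>n. (Z n - ?z) /\<^sub>R T n) \<circ> \<rho>) \<longlonglongrightarrow> \<zeta>'"
    by (rule seq_compactE[OF compact_imp_seq_compact[OF compact_sphere] sph]) (rule that; assumption)
  then have nz: "\<zeta>' \<noteq> 0" by auto
  define t where "t n = T (\<rho> n)" for n
  define \<zeta> where "\<zeta> n = (Z (\<rho> n) - ?z) /\<^sub>R t n" for n
  define r where "r n = R (\<rho> n)" for n
  have t: "\<And>n. 0 < t n" "t \<longlonglongrightarrow> 0"
    using Tpos LIMSEQ_subseq_LIMSEQ[OF T0 \<rho>] by (simp_all add: t_def[abs_def] o_def)
  have \<zeta>: "\<zeta> \<longlonglongrightarrow> \<zeta>'" using conv\<zeta> by (simp add: \<zeta>_def[abs_def] t_def o_def)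
  have Z\<rho>: "Z (\<rho> n) = ?z + t n *\<^sub>R \<zeta> n" for n
    using t(1)[of n] by (simp add: \<zeta>_def)
  have resid: "norm (lagrangian_grad c (?z + t n *\<^sub>R \<zeta> n) /\<^sub>R t n) \<le> 1 / real (Suc n)"
    "norm (r n /\<^sub>R t n) \<le> 1 / real (Suc n)" for n
  proof -
    have "real (Suc n) * (norm (lagrangian_grad c (Z (\<rho> n))) + norm (r n)) \<le>
        real (Suc (\<rho> n)) * (norm (lagrangian_grad c (Z (\<rho> n))) + norm (r n))"
      using seq_suble[OF \<rho>, of n] by (intro mult_right_mono) auto
    also have "\<dots> < t n" using less[of "\<rho> n"] by (simp add: r_def t_def T_def)
    finally have "real (Suc n) * norm (lagrangian_grad c (Z (\<rho> n))) + real (Suc n) * norm (r n) < t n"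
      by (simp add: distrib_left)
    moreover have "0 \<le> real (Suc n) * norm (lagrangian_grad c (Z (\<rho> n)))"
      "0 \<le> real (Suc n) * norm (r n)" by simp_all
    ultimately have "real (Suc n) * norm (lagrangian_grad c (Z (\<rho> n))) \<le> t n"
      "real (Suc n) * norm (r n) \<le> t n" by linarith+
    then show "norm (lagrangian_grad c (?z + t n *\<^sub>R \<zeta> n) /\<^sub>R t n) \<le> 1 / real (Suc n)"
      "norm (r n /\<^sub>R t n) \<le> 1 / real (Suc n)"
      using t(1)[of n] unfolding Z\<rho> by (simp_all add: field_simps)
  qed
  have inv0: "(\<lambda>n. 1 / real (Suc n)) \<longlonglongrightarrow> 0" by (rule LIMSEQ_Suc[OF lim_1_over_n])
  have y: "ybar \<in> subdifferential h (c xbar)" and stat: "transpose (jac c xbar) *v ybar = 0"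
    using M unfolding multipliers_def by auto
  let ?d = "fst \<zeta>'" and ?v = "snd \<zeta>'"
  let ?H = "hessian (scalarized ybar c) xbar" and ?J = "jac c xbar"
  have "(\<lambda>n. (lagrangian_grad c (?z + t n *\<^sub>R \<zeta> n) - lagrangian_grad c ?z) /\<^sub>R t n)
      \<longlonglongrightarrow> lagrangian_grad_deriv c ?z \<zeta>'"
    by (rule has_derivative_along_seq[OF lagrangian_grad_has_derivative[OF C2] t \<zeta>])
  moreover have "lagrangian_grad c ?z = 0" unfolding lagrangian_grad_def fst_conv snd_conv by (rule stat)
  ultimately have "(\<lambda>n. lagrangian_grad c (?z + t n *\<^sub>R \<zeta> n) /\<^sub>R t n)
      \<longlonglongrightarrow> lagrangian_grad_deriv c ?z \<zeta>'" by (simp only: diff_zero)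
  moreover have "(\<lambda>n. lagrangian_grad c (?z + t n *\<^sub>R \<zeta> n) /\<^sub>R t n) \<longlonglongrightarrow> 0"
    using resid(1) by (intro Lim_null_comparison[OF _ inv0] always_eventually allI)
  ultimately have "lagrangian_grad_deriv c ?z \<zeta>' = 0" by (rule LIMSEQ_unique)
  then have lin: "?H *v ?d + transpose ?J *v ?v = 0"
    unfolding lagrangian_grad_deriv_def fst_conv snd_conv .
  \<comment> \<open>The movement of \<open>c\<close> and the residual are merged into one direction,
    so that the inclusion \<open>yk\<close> has the form the tangent lemmas expect.\<close>
  define \<omega> where "\<omega> n = (c (xbar + t n *\<^sub>R fst (\<zeta> n)) - c xbar) /\<^sub>R t n + r n /\<^sub>R t n" for n
  have lim\<omega>: "\<omega> \<longlonglongrightarrow> ?J *v ?d"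
  proof -
    have "(\<lambda>n. (c (xbar + t n *\<^sub>R fst (\<zeta> n)) - c xbar) /\<^sub>R t n) \<longlonglongrightarrow> ?J *v ?d"
      by (rule has_derivative_along_seq[OF C2_smooth_has_derivative[OF C2] t tendsto_fst[OF \<zeta>]])
    moreover have "(\<lambda>n. r n /\<^sub>R t n) \<longlonglongrightarrow> 0"
      using resid(2) by (intro Lim_null_comparison[OF _ inv0] always_eventually allI)
    ultimately have "\<omega> \<longlonglongrightarrow> ?J *v ?d + 0" unfolding \<omega>_def by (rule tendsto_add)
    then show ?thesis by simp
  qed
  have yk: "ybar + t n *\<^sub>R snd (\<zeta> n) \<in> subdifferential h (c xbar + t n *\<^sub>R \<omega> n)" for n
  proof -
    have "c xbar + t n *\<^sub>R \<omega> n = c (fst (Z (\<rho> n))) + R (\<rho> n)"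
      using t(1)[of n] unfolding Z\<rho> by (simp add: \<omega>_def r_def scaleR_add_right)
    then show ?thesis using sub[of "\<rho> n"] unfolding Z\<rho> by simp
  qed
  note lims = t lim\<omega> tendsto_snd[OF \<zeta>]
  have d0: "?d = 0"
  proof (rule ccontr)
    assume d: "?d \<noteq> 0"
    have "ybar \<bullet> (?J *v ?d) = 0"
      using inner_transpose_matrix[of ?J ybar ?d] unfolding stat by simp
    then have "?d \<in> nonascent_dirs h c xbar"
      using dir_derivs_subdifferential_tangent(1)[OF plq y yk lims] by (simp add: nonascent_dirs_def)
    from sosc[OF this d] obtain q where q: "q \<le> ?v \<bullet> (?J *v ?d)" "0 < ereal q + ereal (?d \<bullet> (?H *v ?d))"
      using dir_derivs_subdifferential_tangent(2)[OF plq y yk lims] by auto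
    \<comment> \<open>By \<open>lin\<close> this sum is zero, whereas the upper bound on
      \<open>q\<close> and the second-order condition make it positive.\<close>
    have "?d \<bullet> (?H *v ?d) + ?v \<bullet> (?J *v ?d) = ?d \<bullet> (?H *v ?d + transpose ?J *v ?v)"
      using inner_transpose_matrix[of ?J ?v ?d] unfolding inner_add_right
      by (metis inner_commute)
    then show False using q unfolding lin by simp
  qed
  then have v: "?v \<noteq> 0" using nz by (metis prod.collapse zero_prod_def)
  have "\<omega> \<longlonglongrightarrow> 0" using lim\<omega> d0 by simp
  from subdifferential_vertical_tangent[OF plq conv y yk t this tendsto_snd[OF \<zeta>]]
  obtain s where s: "s > 0" "ybar + s *\<^sub>R ?v \<in> subdifferential h (c xbar)" by blast
  have "transpose ?J *v ?v = 0" using lin d0 by simp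
  then have "transpose ?J *v (ybar + s *\<^sub>R ?v) = 0"
    using stat unfolding matrix_vector_right_distrib matrix_vector_mult_scaleR by simp
  then have "ybar + s *\<^sub>R ?v \<in> multipliers h c xbar"
    using s(2) unfolding multipliers_def by blast
  then show False using M s(1) v by simp
qed

text \<open>The quasi-Newton equation linearizes the Lagrangian gradient at the current pair, with
  \<open>B k\<close> in place of the Hessian. The gradient at the next pair is therefore a
  linearization error, small by strict differentiability, plus the Dennis-More term. The second
  residual is the linearization error of \<open>c\<close>.\<close>

lemma quasi_newton_residual:
  fixes h :: "real^'m \<Rightarrow> ereal" and c :: "real^'n \<Rightarrow> real^'m"
  assumes C2: "C2_smooth c" and qn: "quasi_newton h c B x y"
    and lim: "(\<lambda>k. (x k, y k)) \<longlonglongrightarrow> (xbar, ybar)"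
    and dm: "(\<lambda>k. norm ((B k - hessian (scalarized (y k) c) (x k)) *v (x (Suc k) - x k)))
           \<in> o(\<lambda>k. norm (x (Suc k) - x k, y (Suc k) - y k))"
  shows "(\<lambda>k. norm (lagrangian_grad c (x (Suc k), y (Suc k))))
      \<in> o(\<lambda>k. norm (x (Suc k) - x k, y (Suc k) - y k))"
    and "(\<lambda>k. norm (c (x k) + jac c (x k) *v (x (Suc k) - x k) - c (x (Suc k))))
      \<in> o(\<lambda>k. norm (x (Suc k) - x k, y (Suc k) - y k))"
proof -
  have x: "x \<longlonglongrightarrow> xbar" and xS: "(\<lambda>k. x (Suc k)) \<longlonglongrightarrow> xbar"
    using tendsto_fst[OF lim] by (simp_all add: LIMSEQ_Suc)
  have limS: "(\<lambda>k. (x (Suc k), y (Suc k))) \<longlonglongrightarrow> (xbar, ybar)" by (rule LIMSEQ_Suc[OF lim])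
  define \<sigma> where "\<sigma> k = norm (x (Suc k) - x k, y (Suc k) - y k)" for k
  define \<tau> where "\<tau> k = norm (lagrangian_grad c (x (Suc k), y (Suc k)) - lagrangian_grad c (x k, y k)
      - lagrangian_grad_deriv c (x k, y k) ((x (Suc k), y (Suc k)) - (x k, y k)))" for k
  define \<nu> where
    "\<nu> k = norm ((B k - hessian (scalarized (y k) c) (x k)) *v (x (Suc k) - x k))" for k
  have cont: "isCont (\<lambda>z. lagrangian_grad_deriv c z e) a" for e a
    unfolding lagrangian_grad_deriv_def
    by (intro continuous_add C2_smooth_isCont_hessian[OF C2]
        isCont_o2[OF _ C2_smooth_isCont_transpose_jac[OF C2]] continuous_fst continuous_ident)
  have "\<tau> \<in> o(\<lambda>k. norm ((x (Suc k), y (Suc k)) - (x k, y k)))"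
    unfolding \<tau>_def
    by (rule strictly_differentiable_seq[OF lagrangian_grad_has_derivative[OF C2] cont lim limS])
  then have "\<tau> \<in> o(\<sigma>)" unfolding \<sigma>_def diff_Pair .
  moreover have "\<nu> \<in> o(\<sigma>)" using dm unfolding \<sigma>_def \<nu>_def .
  ultimately have sum: "(\<lambda>k. \<tau> k + \<nu> k) \<in> o(\<sigma>)" by (rule sum_in_smallo)
  have bound: "norm (lagrangian_grad c (x (Suc k), y (Suc k))) \<le> \<tau> k + \<nu> k" for k
  proof -
    let ?J = "jac c (x k)" and ?H = "hessian (scalarized (y k) c) (x k)"
    let ?d = "x (Suc k) - x k" and ?\<eta> = "y (Suc k) - y k"
    have qn: "B k *v ?d + transpose ?J *v y (Suc k) = 0" using qn by (simp add: quasi_newton_def)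
    have J: "transpose ?J *v y (Suc k) = transpose ?J *v y k + transpose ?J *v ?\<eta>"
      by (simp only: matrix_vector_right_distrib[symmetric] add_diff_eq add_diff_cancel_left')
    \<comment> \<open>The gradient is linear in the multiplier: the terms with \<open>y k\<close>
      and with the multiplier step add up to the one with \<open>y (Suc k)\<close>, and the
      quasi-Newton equation can be inserted.\<close>
    have "lagrangian_grad c (x k, y k)
        + lagrangian_grad_deriv c (x k, y k) ((x (Suc k), y (Suc k)) - (x k, y k))
        = ?H *v ?d + transpose ?J *v y (Suc k)"
      unfolding lagrangian_grad_def lagrangian_grad_deriv_def J
      by (simp only: diff_Pair fst_conv snd_conv ac_simps)
    also have "\<dots> = - ((B k - ?H) *v ?d)"
      unfolding minus_unique[OF qn, symmetric] matrix_vector_mult_diff_rdistrib by simp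
    finally have "lagrangian_grad c (x k, y k)
        + lagrangian_grad_deriv c (x k, y k) ((x (Suc k), y (Suc k)) - (x k, y k))
        + (B k - ?H) *v ?d = 0" by (simp only: add.left_inverse)
    then have "lagrangian_grad c (x (Suc k), y (Suc k)) =
        lagrangian_grad c (x (Suc k), y (Suc k)) - (lagrangian_grad c (x k, y k)
          + lagrangian_grad_deriv c (x k, y k) ((x (Suc k), y (Suc k)) - (x k, y k))
          + (B k - ?H) *v ?d)" by (simp only: diff_zero)
    also have "\<dots> =
        (lagrangian_grad c (x (Suc k), y (Suc k)) - lagrangian_grad c (x k, y k)
          - lagrangian_grad_deriv c (x k, y k) ((x (Suc k), y (Suc k)) - (x k, y k)))
        - (B k - ?H) *v ?d" by (simp only: diff_diff_eq)
    finally have "norm (lagrangian_grad c (x (Suc k), y (Suc k))) = norm \<dots>" by (rule arg_cong)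
    then show ?thesis unfolding \<tau>_def \<nu>_def using norm_triangle_ineq4 by (rule ord_eq_le_trans)
  qed
  have "(\<lambda>k. norm (lagrangian_grad c (x (Suc k), y (Suc k)))) \<in> O(\<lambda>k. \<tau> k + \<nu> k)"
    using order_trans[OF bound abs_ge_self]
    by (intro landau_o.bigI[of 1] always_eventually allI zero_less_one)
      (simp only: real_norm_def abs_norm_cancel mult_1)
  from landau_o.big_small_trans[OF this sum]
  show "(\<lambda>k. norm (lagrangian_grad c (x (Suc k), y (Suc k)))) \<in>
      o(\<lambda>k. norm (x (Suc k) - x k, y (Suc k) - y k))" unfolding \<sigma>_def .
  have "(\<lambda>k. norm (c (x (Suc k)) - c (x k) - jac c (x k) *v (x (Suc k) - x k)))
      \<in> o(\<lambda>k. norm (x (Suc k) - x k))"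
    by (rule strictly_differentiable_seq[OF C2_smooth_has_derivative[OF C2]
          C2_smooth_isCont_jac[OF C2] x xS])
  also have "(\<lambda>k. norm (x (Suc k) - x k)) \<in> O(\<lambda>k. norm (x (Suc k) - x k, y (Suc k) - y k))"
    by (intro landau_o.bigI[of 1] always_eventually allI zero_less_one)
      (simp only: real_norm_def abs_norm_cancel mult_1 norm_fst_le)
  finally have "(\<lambda>k. norm (c (x (Suc k)) - c (x k) - jac c (x k) *v (x (Suc k) - x k)))
      \<in> o(\<lambda>k. norm (x (Suc k) - x k, y (Suc k) - y k))" .
  moreover have "norm (c (x (Suc k)) - c (x k) - jac c (x k) *v (x (Suc k) - x k)) =
      norm (c (x k) + jac c (x k) *v (x (Suc k) - x k) - c (x (Suc k)))" for k
    by (subst norm_minus_commute) (simp only: diff_diff_eq)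
  ultimately show "(\<lambda>k. norm (c (x k) + jac c (x k) *v (x (Suc k) - x k) - c (x (Suc k))))
      \<in> o(\<lambda>k. norm (x (Suc k) - x k, y (Suc k) - y k))"
    by (simp only:)
qed

text \<open>The step is at most the sum of two consecutive errors. The new error then occurs on both
  sides of the bound, and its share on the right is absorbed.\<close>

lemma superlinear_convI:
  assumes lim: "z \<longlonglongrightarrow> l" and ne: "\<And>k. z k \<noteq> l"
    and res: "\<rho> \<in> o(\<lambda>k. norm (z (Suc k) - z k))"
    and bound: "\<forall>\<^sub>F k in sequentially. norm (z (Suc k) - l) \<le> \<kappa> * \<rho> k" and \<kappa>: "\<kappa> > 0"
  shows "superlinear_conv z l"
proof -
  have "(\<lambda>k. norm (z (Suc k) - l) / norm (z k - l)) \<longlonglongrightarrow> 0"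
  proof (rule tendstoI)
    fix \<epsilon> :: real assume \<epsilon>: "\<epsilon> > 0"
    \<comment> \<open>The bound 1/2 permits the absorption, which doubles the factor
      \<open>\<epsilon> / 4\<close> to \<open>\<epsilon> / 2\<close>, strictly below
      \<open>\<epsilon>\<close>.\<close>
    define \<delta> where "\<delta> = min (1/2) (\<epsilon> / 4)"
    have \<delta>: "0 < \<delta>" "\<delta> \<le> 1/2" "\<delta> \<le> \<epsilon> / 4" using \<epsilon> by (auto simp: \<delta>_def)
    have "\<forall>\<^sub>F k in sequentially. norm (\<rho> k) \<le> \<delta> / \<kappa> * norm (norm (z (Suc k) - z k))"
      using landau_o.smallD[OF res, of "\<delta> / \<kappa>"] \<delta> \<kappa> by simp
    with bound show "\<forall>\<^sub>F k in sequentially. dist (norm (z (Suc k) - l) / norm (z k - l)) 0 < \<epsilon>"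
    proof eventually_elim
      case (elim k)
      have "\<kappa> * \<rho> k \<le> \<kappa> * (\<delta> / \<kappa> * norm (z (Suc k) - z k))"
        using elim(2) \<kappa> by (intro mult_left_mono) auto
      then have "norm (z (Suc k) - l) \<le> \<delta> * norm (z (Suc k) - z k)"
        using elim(1) \<kappa> by simp
      also have "\<dots> \<le> \<delta> * (norm (z (Suc k) - l) + norm (z k - l))"
        using \<delta>(1) norm_triangle_ineq4[of "z (Suc k) - l" "z k - l"] by (intro mult_left_mono) auto
      also have "\<dots> \<le> 1/2 * norm (z (Suc k) - l) + \<epsilon> / 4 * norm (z k - l)"
        unfolding distrib_left using \<delta> by (intro add_mono mult_right_mono) auto
      finally have "norm (z (Suc k) - l) \<le> \<epsilon> / 2 * norm (z k - l)" by simp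
      moreover have "0 < norm (z k - l)" using ne[of k] by simp
      ultimately have "norm (z (Suc k) - l) / norm (z k - l) \<le> \<epsilon> / 2"
        by (simp add: divide_le_eq)
      also have "\<epsilon> / 2 < \<epsilon>" using \<epsilon> by simp
      finally show ?case by simp
    qed
  qed
  then show ?thesis using lim ne by (simp add: superlinear_conv_def)
qed

theorem corollary5p1:
  fixes h :: "real^'m \<Rightarrow> ereal"
    and c :: "real^'n \<Rightarrow> real^'m"
    and xbar :: "real^'n" and ybar :: "real^'m"
  assumes "plq h"
    and "econvex h"
    and "C2_smooth c"
    and "xbar \<in> edom (h \<circ> c)"
    and "multipliers h c xbar = {ybar}"
    and "\<forall>d \<in> nonascent_dirs h c xbar - {0}.
           dir_deriv2 h (c xbar) (jac c xbar *v d)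
             + ereal (d \<bullet> (hessian (scalarized ybar c) xbar *v d)) > 0"
  shows "0 \<in> (\<lambda>w. ge_map c (xbar, ybar) + w) ` ge_setmap h (xbar, ybar) \<and>
    (\<exists>U. open U \<and> (xbar, ybar) \<in> U \<and>
      (\<forall>(B :: nat \<Rightarrow> real^'n^'n) (x :: nat \<Rightarrow> real^'n) (y :: nat \<Rightarrow> real^'m).
         (x 0, y 0) \<in> U \<longrightarrow>
         quasi_newton h c B x y \<longrightarrow>
         (\<forall>k. (x k, y k) \<in> U \<and> (x k, y k) \<noteq> (xbar, ybar)) \<longrightarrow>
         (\<lambda>k. (x k, y k)) \<longlonglongrightarrow> (xbar, ybar) \<longrightarrow>
         (\<lambda>k. norm ((B k - hessian (scalarized (y k) c) (x k)) *v (x (Suc k) - x k)))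
           \<in> o(\<lambda>k. norm (x (Suc k) - x k, y (Suc k) - y k)) \<longrightarrow>
         superlinear_conv (\<lambda>k. (x k, y k)) (xbar, ybar)))"
proof (rule conjI)
  have y: "ybar \<in> subdifferential h (c xbar)" and stat: "transpose (jac c xbar) *v ybar = 0"
    using assms(5) unfolding multipliers_def by auto
  have "0 = ge_map c (xbar, ybar) + (0, c xbar)"
    by (simp only: ge_map_def prod.case stat add_Pair add_0_left add.left_inverse zero_prod_def)
  moreover have "(0, c xbar) \<in> ge_setmap h (xbar, ybar)"
    using subdifferential_conjugate[OF y] by (simp add: ge_setmap_def)
  ultimately show "0 \<in> (\<lambda>w. ge_map c (xbar, ybar) + w) ` ge_setmap h (xbar, ybar)" by (rule image_eqI)
  obtain \<kappa> \<delta> where \<kappa>: "\<kappa> > 0" and \<delta>: "\<delta> > 0"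
    and bound: "\<And>x y r. norm ((x, y) - (xbar, ybar)) < \<delta> \<Longrightarrow> y \<in> subdifferential h (c x + r) \<Longrightarrow>
      norm ((x, y) - (xbar, ybar)) \<le> \<kappa> * (norm (lagrangian_grad c (x, y)) + norm r)"
    using kkt_error_bound[OF assms(1,2,3,5)] assms(6) by blast
  have main: "superlinear_conv (\<lambda>k. (x k, y k)) (xbar, ybar)"
    if qn: "quasi_newton h c B x y" and ne: "\<forall>k. (x k, y k) \<noteq> (xbar, ybar)"
      and lim: "(\<lambda>k. (x k, y k)) \<longlonglongrightarrow> (xbar, ybar)"
      and dm: "(\<lambda>k. norm ((B k - hessian (scalarized (y k) c) (x k)) *v (x (Suc k) - x k)))
           \<in> o(\<lambda>k. norm (x (Suc k) - x k, y (Suc k) - y k))" for B x y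
  proof -
    \<comment> \<open>This residual leads from \<open>c (x (Suc k))\<close> to the linearized point
      at which \<open>y (Suc k)\<close> is a subgradient, so the error bound applies to the next
      iterate.\<close>
    define r where "r k = c (x k) + jac c (x k) *v (x (Suc k) - x k) - c (x (Suc k))" for k
    show ?thesis
    proof (rule superlinear_convI[OF lim])
      show "(\<lambda>k. norm (lagrangian_grad c (x (Suc k), y (Suc k))) + norm (r k))
          \<in> o(\<lambda>k. norm ((x (Suc k), y (Suc k)) - (x k, y k)))"
        using sum_in_smallo(1)[OF quasi_newton_residual[OF assms(3) qn lim dm]] unfolding r_def diff_Pair .
      have "\<forall>\<^sub>F k in sequentially. dist (x (Suc k), y (Suc k)) (xbar, ybar) < \<delta>"
        by (rule tendstoD[OF LIMSEQ_Suc[OF lim] \<delta>])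
      then show "\<forall>\<^sub>F k in sequentially. norm ((x (Suc k), y (Suc k)) - (xbar, ybar))
          \<le> \<kappa> * (norm (lagrangian_grad c (x (Suc k), y (Suc k))) + norm (r k))"
      proof eventually_elim
        case (elim k)
        have "y (Suc k) \<in> subdifferential h (c (x (Suc k)) + r k)"
          using qn by (simp add: quasi_newton_def r_def)
        then show ?case using elim by (intro bound) (simp_all add: dist_norm)
      qed
    qed (use ne \<kappa> in auto)
  qed
  \<comment> \<open>The whole space serves as \<open>U\<close>: a convergent sequence eventually
    enters the ball of radius \<open>\<delta>\<close> where the error bound holds, and the rate is
    an asymptotic statement.\<close>
  show "\<exists>U. open U \<and> (xbar, ybar) \<in> U \<and>
      (\<forall>(B :: nat \<Rightarrow> real^'n^'n) (x :: nat \<Rightarrow> real^'n) (y :: nat \<Rightarrow> real^'m).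
         (x 0, y 0) \<in> U \<longrightarrow>
         quasi_newton h c B x y \<longrightarrow>
         (\<forall>k. (x k, y k) \<in> U \<and> (x k, y k) \<noteq> (xbar, ybar)) \<longrightarrow>
         (\<lambda>k. (x k, y k)) \<longlonglongrightarrow> (xbar, ybar) \<longrightarrow>
         (\<lambda>k. norm ((B k - hessian (scalarized (y k) c) (x k)) *v (x (Suc k) - x k)))
           \<in> o(\<lambda>k. norm (x (Suc k) - x k, y (Suc k) - y k)) \<longrightarrow>
         superlinear_conv (\<lambda>k. (x k, y k)) (xbar, ybar))"
    by (intro exI[of _ UNIV] conjI open_UNIV UNIV_I allI impI) (rule main, assumption, blast, assumption+)
qed

end
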